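(* Let $1\le p<q<\infty$, $0<\theta_2<\infty$ and $\omega\in A^{\rho,\theta_2}_{p,q}(\mathbb R^d)$. Let $N_0$ and $\eta=\eta(\omega^q)$ be the constants fixed in the context. Then the following statements are true. (1) Let $0<\theta_1<\infty$. There is a constant $C>0$, independent of $f$ and $\mathcal Q$, such that for every $f\in \mathrm{BMO}_{\rho,\theta_1}(\mathbb R^d)$ and every cube $\mathcal Q=Q(x_0,r)\subset\mathbb R^d$, $$\bigg(\frac{1}{\omega^q(\mathcal Q)}\int_{\mathcal Q}|f(x)-f_{\mathcal Q}|^q\,\omega(x)^q\,dx\bigg)^{1/q}\le C\bigg(1+\frac{r}{\rho(x_0)}\bigg)^{(N_0+1)\theta_1+\eta/q}\|f\|_{\mathrm{BMO}_{\rho,\theta_1}}.$$ (2) Conversely, let $f\in L^1_{\mathrm{loc}}(\mathbb R^d)$ be real-valued. If there exist a constant $C>0$ and some $\theta_1>0$ such that for every cube $\mathcal Q=Q(x_0,r)\subset\mathbb R^d$, $$\bigg(\frac{1}{\omega^q(\mathcal Q)}\int_{\mathcal Q}|f(x)-f_{\mathcal Q}|^q\,\omega(x)^q\,dx\bigg)^{1/q}\le C\bigg(1+\frac{r}{\rho(x_0)}\bigg)^{\theta_1-\theta_2},$$ then $f\in \mathrm{BMO}_{\rho,\theta_1}(\mathbb R^d)$ and $$\|f\|_{\mathrm{BMO}_{\rho,\theta_1}}\le C'\,[\omega]_{A^{\rho,\theta_2}_{p,q}},$$ where $C'>0$ depends only on $C,d,p,q,\theta_1,\theta_2$.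
   Context: Setting: $d\ge 3$, and $V:\mathbb R^d\to[0,\infty)$ is locally integrable, not identically zero, and belongs to the reverse Hölder class $RH_s(\mathbb R^d)$ for some $s\ge d/2$, i.e. there is a constant $C>0$ with $\big(\frac1{|B|}\int_B V^s\big)^{1/s}\le C\,\frac1{|B|}\int_B V$ for every ball $B$ (usual modification if $s=\infty$). $B(x,r)$ is the open ball with center $x$ and radius $r$. The critical radius function is $$\rho(x):=\sup\Big\{r>0:\ \frac{1}{r^{d-2}}\int_{B(x,r)}V(y)\,dy\le 1\Big\},\qquad x\in\mathbb R^d,$$ which satisfies $0<\rho(x)<\infty$. Constant $N_0$: it is known (Shen) that there are constants $C_0\ge1$, $N_0>0$ such that for all $x,y\in\mathbb R^d$ $$\frac1{C_0}\Big(1+\frac{|x-y|}{\rho(x)}\Big)^{-N_0}\le\frac{\rho(y)}{\rho(x)}\le C_0\Big(1+\frac{|x-y|}{\rho(x)}\Big)^{\frac{N_0}{N_0+1}};$$ such constants are fixed. Cubes: $Q(x_0,r)$ is the cube centered at $x_0$ with sidelength $r$ and sides parallel to the axes. $f_{\mathcal Q}:=\frac1{|\mathcal Q|}\int_{\mathcal Q}f$. Weights: a weight is a nonnegative locally integrable function $\omega$ on $\mathbb R^d$, not a.e. zero; $\omega^q(x)=\omega(x)^q$ and $\omega^q(E):=\int_E\omega(x)^q\,dx$. Let $p'$ denote the conjugate exponent, $1/p+1/p'=1$. For $0<\theta<\infty$ and $1<p,q<\infty$, $\omega\in A_{p,q}^{\rho,\theta}(\mathbb R^d)$ means $[\omega]_{A_{p,q}^{\rho,\theta}}<\infty$,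 where $$[\omega]_{A^{\rho,\theta}_{p,q}}:=\sup_{B=B(x_0,r)}\Big(1+\frac r{\rho(x_0)}\Big)^{-\theta}\Big(\frac1{|B|}\int_B\omega^q\Big)^{1/q}\Big(\frac1{|B|}\int_B\omega^{-p'}\Big)^{1/p'},$$ and, for $1<q<\infty$, $\omega\in A_{1,q}^{\rho,\theta}(\mathbb R^d)$ means $[\omega]_{A_{1,q}^{\rho,\theta}}:=\sup_{B=B(x_0,r)}\big(1+\frac r{\rho(x_0)}\big)^{-\theta}\big(\frac1{|B|}\int_B\omega^q\big)^{1/q}\big(\operatorname{ess\,inf}_{B}\omega\big)^{-1}<\infty$. (Balls may be replaced by cubes in these definitions, giving the same classes.) Constant $\eta$: for $\omega\in A_{p,q}^{\rho,\theta_2}(\mathbb R^d)$ with $1\le p<q<\infty$, there exist $\epsilon>0$, $\eta>1$, $C>0$ such that for every cube $\mathcal Q=Q(x_0,r)$ $$\Big(\frac1{|\mathcal Q|}\int_{\mathcal Q}(\omega^q)^{1+\epsilon}\Big)^{\frac1{1+\epsilon}}\le C\Big(\frac1{|\mathcal Q|}\int_{\mathcal Q}\omega^q\Big)\Big(1+\frac r{\rho(x_0)}\Big)^{\eta}.$$ $\eta=\eta(\omega^q)$ denotes such an exponent, fixed for $\omega^q$. BMO: for $0<\theta<\infty$, $\mathrm{BMO}_{\rho,\theta}(\mathbb R^d)$ is the set of real-valued $f\in L^1_{\mathrm{loc}}(\mathbb R^d)$ with $$\|f\|_{\mathrm{BMO}_{\rho,\theta}}:=\sup_{Q=Q(x_0,r)}\Big(1+\frac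 r{\rho(x_0)}\Big)^{-\theta}\frac1{|Q|}\int_Q|f(x)-f_Q|\,dx<\infty,$$ the supremum being over all cubes $Q(x_0,r)$, $x_0\in\mathbb R^d$, $r>0$. *)

theory Defs
  imports "HOL-Analysis.Analysis" "HOL-Probability.Essential_Supremum"
begin

text \<open>Integrals and suprema of nonnegative quantities are taken in \<^typ>\<open>ennreal\<close>, so that an
  inequality between them never holds merely because an integral diverges.\<close>

definition cube :: "'a::euclidean_space \<Rightarrow> real \<Rightarrow> 'a set" where
  "cube x0 r = cbox (x0 - (r / 2) *\<^sub>R One) (x0 + (r / 2) *\<^sub>R One)"

text \<open>Only used with a positive exponent \<open>a\<close>; then \<open>\<infinity>\<close> to the power \<open>a\<close> is \<open>\<infinity>\<close>.\<close>
definition ennpowr :: "ennreal \<Rightarrow> real \<Rightarrow> ennreal" where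
  "ennpowr x a = (if x = \<infinity> then \<infinity> else ennreal (enn2real x powr a))"

definition avg :: "'a::euclidean_space set \<Rightarrow> ('a \<Rightarrow> real) \<Rightarrow> real" where
  "avg E f = set_lebesgue_integral lebesgue E f / measure lebesgue E"

definition nn_avg :: "'a::euclidean_space set \<Rightarrow> ('a \<Rightarrow> ennreal) \<Rightarrow> ennreal" where
  "nn_avg E g = (\<integral>\<^sup>+x\<in>E. g x \<partial>lebesgue) / emeasure lebesgue E"

definition locally_integrable :: "('a::euclidean_space \<Rightarrow> real) \<Rightarrow> bool" where
  "locally_integrable f \<longleftrightarrow> (\<forall>K. compact K \<longrightarrow> f absolutely_integrable_on K)"

definition reverse_holder :: "ereal \<Rightarrow> ('a::euclidean_space \<Rightarrow> real) \<Rightarrow> bool" where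
  "reverse_holder s V \<longleftrightarrow> (\<exists>C>0. \<forall>x. \<forall>r>0.
     (if s = \<infinity> then esssup (lebesgue_on (ball x r)) (\<lambda>y. ennreal (V y))
      else ennpowr (nn_avg (ball x r) (\<lambda>y. ennreal (V y powr real_of_ereal s)))
             (1 / real_of_ereal s))
     \<le> ennreal C * nn_avg (ball x r) (\<lambda>y. ennreal (V y)))"

text \<open>As \<open>V\<close> is a locally integrable function, \<open>not identically zero\<close> means not almost
  everywhere zero.\<close>
definition admissible_potential :: "('a::euclidean_space \<Rightarrow> real) \<Rightarrow> bool" where
  "admissible_potential V \<longleftrightarrow>
     (\<forall>x. 0 \<le> V x) \<and> locally_integrable V \<and> \<not> (AE x in lebesgue. V x = 0) \<and>
     (\<exists>s. ereal (real DIM('a) / 2) \<le> s \<and> reverse_holder s V)"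

text \<open>For an admissible potential in dimension at least 3 the set below is nonempty and bounded
  above, so this real supremum is the true one.\<close>
definition critical_radius :: "('a::euclidean_space \<Rightarrow> real) \<Rightarrow> 'a \<Rightarrow> real" where
  "critical_radius V x =
     Sup {r. 0 < r \<and> 1 / r ^ (DIM('a) - 2) * set_lebesgue_integral lebesgue (ball x r) V \<le> 1}"

definition shen_exponent :: "('a::euclidean_space \<Rightarrow> real) \<Rightarrow> real \<Rightarrow> bool" where
  "shen_exponent \<rho> N0 \<longleftrightarrow> 0 < N0 \<and> (\<exists>C0\<ge>1. \<forall>x y.
     1 / C0 * (1 + norm (x - y) / \<rho> x) powr (- N0) \<le> \<rho> y / \<rho> x \<and>
     \<rho> y / \<rho> x \<le> C0 * (1 + norm (x - y) / \<rho> x) powr (N0 / (N0 + 1)))"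

definition weight :: "('a::euclidean_space \<Rightarrow> real) \<Rightarrow> bool" where
  "weight \<omega> \<longleftrightarrow>
     (\<forall>x. 0 \<le> \<omega> x) \<and> locally_integrable \<omega> \<and> \<not> (AE x in lebesgue. \<omega> x = 0)"

text \<open>The essential infimum, dual to the library's \<^const>\<open>esssup\<close>.\<close>
definition ess_inf :: "'a::euclidean_space set \<Rightarrow> ('a \<Rightarrow> ennreal) \<Rightarrow> ennreal" where
  "ess_inf E g = Liminf (ae_filter (lebesgue_on E)) g"

text \<open>Negative powers are written as \<^const>\<open>inverse\<close> in \<^typ>\<open>ennreal\<close>, so that they are
  \<open>\<infinity>\<close> where \<open>\<omega>\<close> vanishes. The conjugate exponent of \<open>p > 1\<close> is \<open>p / (p - 1)\<close>.\<close>
definition A_const ::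
    "('a::euclidean_space \<Rightarrow> real) \<Rightarrow> real \<Rightarrow> real \<Rightarrow> real \<Rightarrow> ('a \<Rightarrow> real) \<Rightarrow> ennreal" where
  "A_const \<rho> \<theta> p q \<omega> = (SUP x0. SUP r\<in>{0<..}.
     ennreal ((1 + r / \<rho> x0) powr (- \<theta>)) *
     ennpowr (nn_avg (ball x0 r) (\<lambda>x. ennreal (\<omega> x powr q))) (1 / q) *
     (if p = 1 then inverse (ess_inf (ball x0 r) (\<lambda>x. ennreal (\<omega> x)))
      else let p' = p / (p - 1) in
        ennpowr (nn_avg (ball x0 r) (\<lambda>x. inverse (ennreal (\<omega> x powr p')))) (1 / p')))"

definition A_class ::
    "('a::euclidean_space \<Rightarrow> real) \<Rightarrow> real \<Rightarrow> real \<Rightarrow> real \<Rightarrow> ('a \<Rightarrow> real) set" where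
  "A_class \<rho> \<theta> p q = {\<omega>. weight \<omega> \<and> A_const \<rho> \<theta> p q \<omega> < \<infinity>}"

text \<open>\<open>\<eta>\<close> is an admissible exponent in the reverse Hoelder inequality for \<open>w\<close>; it is applied
  to \<open>w = \<omega>\<^sup>q\<close>.\<close>
definition rh_exponent ::
    "('a::euclidean_space \<Rightarrow> real) \<Rightarrow> ('a \<Rightarrow> real) \<Rightarrow> real \<Rightarrow> bool" where
  "rh_exponent \<rho> w \<eta> \<longleftrightarrow> 1 < \<eta> \<and> (\<exists>\<epsilon>>0. \<exists>C>0. \<forall>x0. \<forall>r>0.
     ennpowr (nn_avg (cube x0 r) (\<lambda>x. ennreal (w x powr (1 + \<epsilon>)))) (1 / (1 + \<epsilon>))
     \<le> ennreal C * nn_avg (cube x0 r) (\<lambda>x. ennreal (w x)) *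
        ennreal ((1 + r / \<rho> x0) powr \<eta>))"

definition bmo_norm ::
    "('a::euclidean_space \<Rightarrow> real) \<Rightarrow> real \<Rightarrow> ('a \<Rightarrow> real) \<Rightarrow> ennreal" where
  "bmo_norm \<rho> \<theta> f = (SUP x0. SUP r\<in>{0<..}.
     ennreal ((1 + r / \<rho> x0) powr (- \<theta>)) *
     nn_avg (cube x0 r) (\<lambda>x. ennreal \<bar>f x - avg (cube x0 r) f\<bar>))"

definition BMO :: "('a::euclidean_space \<Rightarrow> real) \<Rightarrow> real \<Rightarrow> ('a \<Rightarrow> real) set" where
  "BMO \<rho> \<theta> = {f. locally_integrable f \<and> bmo_norm \<rho> \<theta> f < \<infinity>}"

definition weighted_osc ::
    "real \<Rightarrow> ('a::euclidean_space \<Rightarrow> real) \<Rightarrow> ('a \<Rightarrow> real) \<Rightarrow> 'a set \<Rightarrow> ennreal" where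
  "weighted_osc q \<omega> f Q =
     ennpowr ((\<integral>\<^sup>+x\<in>Q. ennreal (\<bar>f x - avg Q f\<bar> powr q * \<omega> x powr q) \<partial>lebesgue) /
              (\<integral>\<^sup>+x\<in>Q. ennreal (\<omega> x powr q) \<partial>lebesgue)) (1 / q)"

end

theory Submission
  imports Defs
begin

text \<open>Both halves rest on Hoelder's inequality for the weight; the substance of the first is the
  inequality of John and Nirenberg.

  A function in the space with norm \<^const>\<open>bmo_norm\<close> has, on a fixed cube of side \<open>r\<close> and centre
  \<open>x0\<close>, bounded mean oscillation in the ordinary sense: by Shen's inequalities the scale \<open>1 + t / \<rho> y\<close> of
  any subcube is at most a constant times \<open>(1 + r / \<rho> x0) powr (N0 + 1)\<close> (\<open>scale_of_subcube_le\<close>). By John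
  and Nirenberg the same bound, up to a constant, then holds for its \<open>L\<^sup>s\<close> oscillation on the cube for
  every \<open>s > 1\<close> (\<open>John_Nirenberg_cube\<close>), and the reverse Hoelder inequality for the weight passes from
  these to the weighted oscillation (\<open>weighted_osc_le_bmo_norm\<close>).

  The inequality of John and Nirenberg is proved for harmonic functions on trees, where the averages of
  \<open>f\<close> over dyadic subcubes of finitely many generations form a finite problem that is settled by a
  stopping argument and induction (\<open>stopping_estimate\<close>, \<open>power_oscillation_le\<close>). The density of continuous
  functions in \<open>L\<^sup>1\<close> then leads from the averages back to \<open>f\<close> (\<open>avg_Lipschitz_le_if_means_le\<close>).

  For the converse one writes \<open>\<bar>f - avg Q f\<bar>\<close> as the product of \<open>\<bar>f - avg Q f\<bar> * \<omega>\<close> and \<open>1 / \<omega>\<close>; Hoelder's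
  inequality with the exponents \<open>q\<close> and \<open>q / (q - 1)\<close> produces the weighted oscillation and the two averages
  in \<^const>\<open>A_const\<close>, whose second exponent may be lowered as \<open>p < q\<close> (\<open>A_const_diagonal_le\<close>,
  \<open>bmo_norm_le_A_const\<close>). The comparison of the scales of a cube and of a ball around it presupposes that
  the critical radius is positive, which follows from the reverse Hoelder inequality for \<open>V\<close>
  (\<open>critical_radius_pos\<close>).\<close>

section \<open>Powers and Hoelder's inequality for extended nonnegative functions\<close>

lemma ennpowr_ennreal [simp]: "0 \<le> x \<Longrightarrow> ennpowr (ennreal x) a = ennreal (x powr a)"
  by (simp add: ennpowr_def)

lemma ennpowr_top [simp]: "ennpowr top a = top"
  by (simp add: ennpowr_def)

lemma ennpowr_0 [simp]: "ennpowr 0 a = 0"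
  by (simp add: ennpowr_def)

lemma ennpowr_1 [simp]: "ennpowr x 1 = x"
  by (cases x) auto

lemma ennpowr_one [simp]: "ennpowr 1 a = 1"
  by (simp add: ennpowr_def)

lemma ennpowr_mono: "0 \<le> a \<Longrightarrow> x \<le> y \<Longrightarrow> ennpowr x a \<le> ennpowr y a"
  by (cases x; cases y) (auto simp: top_unique powr_mono2)

lemma ennpowr_mult: "0 < a \<Longrightarrow> ennpowr (x * y) a = ennpowr x a * ennpowr y a"
  by (cases "x = 0"; cases "y = 0"; cases x; cases y)
     (auto simp: ennreal_mult_top ennreal_top_mult powr_mult simp flip: ennreal_mult)

lemma ennpowr_ennpowr: "ennpowr (ennpowr x a) b = ennpowr x (a * b)"
  by (cases x) (auto simp: powr_powr)

lemma ennpowr_inverse: "0 < a \<Longrightarrow> ennpowr (inverse x) a = inverse (ennpowr x a)"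
proof (cases x)
  case (real r)
  show "0 < a \<Longrightarrow> ?thesis"
  proof (cases "r = 0")
    case False
    then show ?thesis using real by (simp add: inverse_ennreal powr_divide inverse_eq_divide powr_one_eq_one)
  qed (use real in auto)
qed auto

lemma ennpowr_divide: "0 < a \<Longrightarrow> ennpowr (x / y) a = ennpowr x a / ennpowr y a"
  by (simp add: divide_ennreal_def ennpowr_mult ennpowr_inverse)

lemma ennpowr_add: "0 < a \<Longrightarrow> 0 < b \<Longrightarrow> ennpowr x a * ennpowr x b = ennpowr x (a + b)"
  by (cases x) (auto simp: powr_add simp flip: ennreal_mult)

lemma ennpowr_eq_0_iff [simp]: "ennpowr x a = 0 \<longleftrightarrow> x = 0"
  by (cases x) (auto simp: ennpowr_def)

lemma ennpowr_eq_top_iff [simp]: "ennpowr x a = top \<longleftrightarrow> x = top"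
  by (cases x) (auto simp: ennpowr_def)

lemma borel_measurable_ennpowr [measurable (raw)]:
  assumes [measurable]: "f \<in> borel_measurable M"
  shows "(\<lambda>x. ennpowr (f x) a) \<in> borel_measurable M"
  unfolding ennpowr_def by measurable

lemma Young_ennreal:
  assumes "1 < s" "1 < t" "1 / s + 1 / t = 1"
  shows "a * b \<le> ennreal (1 / s) * ennpowr a s + ennreal (1 / t) * ennpowr b t"
proof (cases a)
  case (real x)
  show ?thesis
  proof (cases b)
    case b: (real y)
    have "x * y \<le> x powr s / s + y powr t / t"
      using Youngs_inequality[of s t x y] assms real b by auto
    then have "ennreal (x * y) \<le> ennreal (1 / s * x powr s + 1 / t * y powr t)"
      by (intro ennreal_leI) simp
    also have "\<dots> = ennreal (1 / s) * ennreal (x powr s) + ennreal (1 / t) * ennreal (y powr t)"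
      using assms by (simp flip: ennreal_mult)
    finally show ?thesis
      using real b by (simp add: ennreal_mult)
  qed (use assms in \<open>auto simp: ennreal_mult_top\<close>)
qed (use assms in \<open>auto simp: ennreal_mult_top\<close>)

text \<open>Normalising both factors to integral one reduces the inequality to the pointwise one of Young.\<close>
lemma Hoelder_nn_integral:
  assumes st: "1 < s" "1 < t" "1 / s + 1 / t = 1"
    and [measurable]: "u \<in> borel_measurable M" "v \<in> borel_measurable M"
  shows "(\<integral>\<^sup>+x. u x * v x \<partial>M)
    \<le> ennpowr (\<integral>\<^sup>+x. ennpowr (u x) s \<partial>M) (1 / s) * ennpowr (\<integral>\<^sup>+x. ennpowr (v x) t \<partial>M) (1 / t)"
    (is "_ \<le> ennpowr ?A _ * ennpowr ?B _")
proof -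
  consider "?A = 0 \<or> ?B = 0" | "?A \<noteq> 0" "?B \<noteq> 0" "?A = top \<or> ?B = top"
    | "?A \<noteq> 0" "?B \<noteq> 0" "?A \<noteq> top" "?B \<noteq> top" by blast
  then show ?thesis
  proof cases
    case 1
    then have "AE x in M. u x * v x = 0"
      by (auto simp: nn_integral_0_iff_AE)
    then have "(\<integral>\<^sup>+x. u x * v x \<partial>M) = 0"
      by (subst nn_integral_0_iff_AE) auto
    then show ?thesis by simp
  next
    case 2
    then show ?thesis by (auto simp: ennreal_mult_top ennreal_top_mult)
  next
    case 3
    define \<alpha> \<beta> where "\<alpha> = ennpowr ?A (1 / s)" and "\<beta> = ennpowr ?B (1 / t)"
    have \<alpha>: "\<alpha> \<noteq> 0" "\<alpha> \<noteq> top" "ennpowr \<alpha> s = ?A" and \<beta>: "\<beta> \<noteq> 0" "\<beta> \<noteq> top" "ennpowr \<beta> t = ?B"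
      using 3 st by (auto simp: \<alpha>_def \<beta>_def ennpowr_ennpowr)
    have "(\<integral>\<^sup>+x. u x * v x \<partial>M) = (\<integral>\<^sup>+x. (\<alpha> * \<beta>) * (u x / \<alpha> * (v x / \<beta>)) \<partial>M)"
    proof (rule nn_integral_cong)
      fix x
      have "u x = \<alpha> * (u x / \<alpha>)" "v x = \<beta> * (v x / \<beta>)"
        using \<alpha> \<beta> by (simp_all add: ennreal_times_divide mult.commute[of _ "u x"] mult.commute[of _ "v x"]
            ennreal_mult_divide_eq)
      then show "u x * v x = (\<alpha> * \<beta>) * (u x / \<alpha> * (v x / \<beta>))"
        by (metis mult.assoc mult.left_commute)
    qed
    also have "\<dots> = \<alpha> * \<beta> * (\<integral>\<^sup>+x. u x / \<alpha> * (v x / \<beta>) \<partial>M)"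
      by (rule nn_integral_cmult) measurable
    also have "(\<integral>\<^sup>+x. u x / \<alpha> * (v x / \<beta>) \<partial>M)
        \<le> (\<integral>\<^sup>+x. ennreal (1 / s) * ennpowr (u x / \<alpha>) s + ennreal (1 / t) * ennpowr (v x / \<beta>) t \<partial>M)"
      by (intro nn_integral_mono Young_ennreal st)
    also have "\<dots> = ennreal (1 / s) * (\<integral>\<^sup>+x. ennpowr (u x) s \<partial>M) / ?A + ennreal (1 / t) * (\<integral>\<^sup>+x. ennpowr (v x) t \<partial>M) / ?B"
      using st \<alpha> \<beta> by (simp add: nn_integral_add nn_integral_cmult ennpowr_divide nn_integral_divide ennreal_times_divide)
    also have "\<dots> = ennreal (1 / s) + ennreal (1 / t)"
      using 3 by (simp add: ennreal_mult_divide_eq)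
    also have "\<dots> = 1"
      using st by (simp flip: ennreal_plus)
    finally show ?thesis
      by (simp add: \<alpha>_def \<beta>_def mult_left_mono)
  qed
qed

lemma nn_avg_eq_nn_integral_uniform_measure:
  assumes "g \<in> borel_measurable lebesgue" "E \<in> sets lebesgue"
  shows "nn_avg E g = (\<integral>\<^sup>+x. g x \<partial>uniform_measure lebesgue E)"
  using assms by (simp add: nn_avg_def nn_integral_uniform_measure)

lemma Hoelder_nn_avg:
  assumes "1 < s" "1 < t" "1 / s + 1 / t = 1"
    and [measurable]: "u \<in> borel_measurable lebesgue" "v \<in> borel_measurable lebesgue" "E \<in> sets lebesgue"
  shows "nn_avg E (\<lambda>x. u x * v x)
    \<le> ennpowr (nn_avg E (\<lambda>x. ennpowr (u x) s)) (1 / s) * ennpowr (nn_avg E (\<lambda>x. ennpowr (v x) t)) (1 / t)"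
  using Hoelder_nn_integral[OF assms(1-3), of u "uniform_measure lebesgue E" v]
  by (simp add: nn_avg_eq_nn_integral_uniform_measure)

lemma nn_avg_mono_AE:
  assumes "AE x in lebesgue. x \<in> E \<longrightarrow> g x \<le> h x"
  shows "nn_avg E g \<le> nn_avg E h"
  unfolding nn_avg_def
  by (intro divide_right_mono_ennreal nn_integral_mono_AE) (use assms in \<open>auto elim!: eventually_mono simp: indicator_def\<close>)

lemma nn_avg_const_le:
  assumes "E \<in> sets lebesgue"
  shows "nn_avg E (\<lambda>x. c) \<le> c"
proof -
  consider "emeasure lebesgue E = 0" | "emeasure lebesgue E = top"
    | "emeasure lebesgue E \<noteq> 0" "emeasure lebesgue E \<noteq> top" by blast
  then show ?thesis
    using assms by cases (auto simp: nn_avg_def nn_integral_cmult_indicator ennreal_mult_divide_eq)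
qed

text \<open>Jensen's inequality for powers is the case of Hoelder's inequality with one factor constant.\<close>
lemma power_mean_nn_avg:
  assumes ab: "0 < a" "a \<le> b"
    and [measurable]: "h \<in> borel_measurable lebesgue" "E \<in> sets lebesgue"
  shows "ennpowr (nn_avg E (\<lambda>x. ennpowr (h x) a)) (1 / a) \<le> ennpowr (nn_avg E (\<lambda>x. ennpowr (h x) b)) (1 / b)"
proof (cases "a = b")
  case False
  define s t where "s = b / a" and "t = b / (b - a)"
  have st: "1 < s" "1 < t" "1 / s + 1 / t = 1"
    using ab False by (auto simp: s_def t_def field_simps)
  have "nn_avg E (\<lambda>x. ennpowr (h x) a) = nn_avg E (\<lambda>x. ennpowr (h x) a * 1)"
    by simp
  also have "\<dots> \<le> ennpowr (nn_avg E (\<lambda>x. ennpowr (ennpowr (h x) a) s)) (1 / s) * ennpowr (nn_avg E (\<lambda>x. ennpowr 1 t)) (1 / t)"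
    by (rule Hoelder_nn_avg[OF st]) auto
  also have "\<dots> \<le> ennpowr (nn_avg E (\<lambda>x. ennpowr (ennpowr (h x) a) s)) (1 / s) * 1"
    using st ennpowr_mono[OF _ nn_avg_const_le[of E 1], of "1 / t"] assms(4) by (intro mult_left_mono) auto
  also have "\<dots> = ennpowr (nn_avg E (\<lambda>x. ennpowr (h x) b)) (a / b)"
    using ab by (simp add: ennpowr_ennpowr s_def)
  finally have "ennpowr (nn_avg E (\<lambda>x. ennpowr (h x) a)) (1 / a)
      \<le> ennpowr (ennpowr (nn_avg E (\<lambda>x. ennpowr (h x) b)) (a / b)) (1 / a)"
    using ab by (intro ennpowr_mono) auto
  then show ?thesis using ab by (simp add: ennpowr_ennpowr)
qed simp

section \<open>The John-Nirenberg inequality on trees\<close>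

lemma powr_sum_le:
  fixes a b s :: real
  assumes "0 \<le> a" "0 \<le> b" "0 \<le> s"
  shows "(a + b) powr s \<le> 2 powr s * (a powr s + b powr s)"
proof -
  have "(a + b) powr s \<le> (2 * max a b) powr s"
    using assms by (intro powr_mono2) auto
  also have "\<dots> = 2 powr s * max a b powr s"
    using assms by (simp add: powr_mult)
  also have "max a b powr s \<le> a powr s + b powr s"
    by (auto simp: max_def)
  finally show ?thesis by simp
qed

text \<open>The nodes stand for dyadic cubes, whose children all have the same measure; the averages of an
  integrable function over the cubes are then harmonic. On the tree only finite sums occur.\<close>
locale averaging_tree =
  fixes child :: "'i \<Rightarrow> 'v \<Rightarrow> 'v" and I :: "'i set" and node :: "'v \<Rightarrow> bool"
  assumes finite_I: "finite I" and I_nonempty: "I \<noteq> {}"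
    and node_child: "node v \<Longrightarrow> i \<in> I \<Longrightarrow> node (child i v)"
begin

primrec descendants :: "nat \<Rightarrow> 'v \<Rightarrow> 'v set" where
  "descendants 0 v = {v}"
| "descendants (Suc k) v = (\<Union>i\<in>I. descendants k (child i v))"

primrec mean :: "nat \<Rightarrow> ('v \<Rightarrow> real) \<Rightarrow> 'v \<Rightarrow> real" where
  "mean 0 G v = G v"
| "mean (Suc k) G v = (\<Sum>i\<in>I. mean k G (child i v)) / card I"

definition harmonic :: "('v \<Rightarrow> real) \<Rightarrow> bool" where
  "harmonic g \<longleftrightarrow> (\<forall>v. node v \<longrightarrow> g v = (\<Sum>i\<in>I. g (child i v)) / card I)"

lemma card_I_pos: "0 < real (card I)"
  using finite_I I_nonempty by (simp add: card_gt_0_iff)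

lemma node_descendant: "node v \<Longrightarrow> w \<in> descendants k v \<Longrightarrow> node w"
  by (induction k arbitrary: v) (auto dest: node_child)

lemma mean_mono:
  "(\<And>w. w \<in> descendants k v \<Longrightarrow> G w \<le> H w) \<Longrightarrow> mean k G v \<le> mean k H v"
  by (induction k arbitrary: v) (auto intro!: divide_right_mono sum_mono)

lemma mean_add: "mean k (\<lambda>w. G w + H w) v = mean k G v + mean k H v"
  by (induction k arbitrary: v) (auto simp: sum.distrib add_divide_distrib)

lemma mean_cmult: "mean k (\<lambda>w. c * G w) v = c * mean k G v"
  by (induction k arbitrary: v) (auto simp: sum_distrib_left)

lemma mean_const: "mean k (\<lambda>w. c) v = c"
  using card_I_pos by (induction k arbitrary: v) auto

lemma mean_harmonic: "harmonic g \<Longrightarrow> node v \<Longrightarrow> mean k g v = g v"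
proof (induction k arbitrary: v)
  case (Suc k)
  then have "mean (Suc k) g v = (\<Sum>i\<in>I. g (child i v)) / card I"
    using node_child by simp
  then show ?case using Suc.prems by (simp add: harmonic_def)
qed simp

lemma abs_diff_le_mean:
  assumes "harmonic g" "node v"
  shows "\<bar>g v - a\<bar> \<le> mean k (\<lambda>w. \<bar>g w - a\<bar>) v"
proof -
  have 1: "mean k (\<lambda>w. \<epsilon> * g w + (- \<epsilon> * a)) v = \<epsilon> * g v + (- \<epsilon> * a)" for \<epsilon>
    using assms by (simp only: mean_add mean_cmult mean_const mean_harmonic)
  have 2: "mean k (\<lambda>w. \<epsilon> * g w + (- \<epsilon> * a)) v \<le> mean k (\<lambda>w. \<bar>g w - a\<bar>) v" if "\<epsilon> = 1 \<or> \<epsilon> = -1" for \<epsilon>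
    using that by (intro mean_mono) auto
  show ?thesis
    using 1[of 1] 1[of "-1"] 2[of 1] 2[of "-1"] by linarith
qed

text \<open>This is the stopping time argument of Calderon and Zygmund. The tree is cut at the first nodes
  where \<open>\<bar>g - a\<bar>\<close> exceeds the height \<open>l\<close>. As a step changes \<open>g\<close> by at most \<open>c\<close>, there \<open>\<bar>g - a\<bar>\<close> is still
  at most \<open>l + c\<close>, so that below such a node the powers of \<open>g - a\<close> are controlled by those of the
  oscillation of \<open>g\<close> around the node; and by Markov's inequality the cut nodes carry a fraction of at
  most \<open>mean k (\<lambda>w. \<bar>g w - a\<bar>) v / l\<close>. Packed into one inequality, these facts pass from the children
  to the parent.\<close>
lemma stopping_estimate:
  assumes g: "harmonic g" and s: "0 \<le> s" and l: "0 < l" "0 \<le> c" and M: "0 \<le> M"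
    and step: "\<And>v i. node v \<Longrightarrow> i \<in> I \<Longrightarrow> \<bar>g (child i v) - g v\<bar> \<le> c"
    and osc: "\<And>j u. j \<le> k \<Longrightarrow> node u \<Longrightarrow> mean j (\<lambda>w. \<bar>g w - g u\<bar> powr s) u \<le> M"
    and v: "node v" "\<bar>g v - a\<bar> \<le> l + c"
  shows "mean k (\<lambda>w. \<bar>g w - a\<bar> powr s) v
    \<le> l powr s + 2 powr s * (M + (l + c) powr s) / l * mean k (\<lambda>w. \<bar>g w - a\<bar>) v"
  using osc v
proof (induction k arbitrary: v)
  case (0 v)
  define A where "A = 2 powr s * (M + (l + c) powr s)"
  show ?case
  proof (cases "\<bar>g v - a\<bar> \<le> l")
    case True
    then have "\<bar>g v - a\<bar> powr s \<le> l powr s"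
      using s by (intro powr_mono2) auto
    moreover have "0 \<le> A / l * \<bar>g v - a\<bar>"
      using l M by (simp add: A_def)
    ultimately show ?thesis by (simp add: A_def)
  next
    case False
    (* Here Markov's inequality enters: at a cut node the mean of \<bar>g - a\<bar> exceeds l. *)
    have "\<bar>g v - a\<bar> powr s \<le> 1 * (M + (l + c) powr s)"
      using powr_mono2[of s "\<bar>g v - a\<bar>" "l + c"] 0(3) s M by simp
    also have "\<dots> \<le> A"
      unfolding A_def using s M by (intro mult_right_mono) (auto simp: ge_one_powr_ge_zero)
    also have "\<dots> = A / l * l"
      using l by simp
    also have "\<dots> \<le> A / l * \<bar>g v - a\<bar>"
      using False l M by (intro mult_left_mono) (auto simp: A_def)
    finally show ?thesis
      unfolding A_def mean.simps by (intro add_increasing) auto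
  qed
next
  case (Suc k v)
  define A where "A = 2 powr s * (M + (l + c) powr s)"
  show ?case
  proof (cases "\<bar>g v - a\<bar> \<le> l")
    case True
    have "mean k (\<lambda>w. \<bar>g w - a\<bar> powr s) (child i v)
        \<le> l powr s + A / l * mean k (\<lambda>w. \<bar>g w - a\<bar>) (child i v)" if "i \<in> I" for i
      unfolding A_def using that True step[OF Suc.prems(2) that] Suc.prems(1,2)
      by (intro Suc.IH node_child) auto
    then have "mean (Suc k) (\<lambda>w. \<bar>g w - a\<bar> powr s) v
        \<le> (\<Sum>i\<in>I. l powr s + A / l * mean k (\<lambda>w. \<bar>g w - a\<bar>) (child i v)) / card I"
      using card_I_pos by (auto intro!: divide_right_mono sum_mono)
    also have "\<dots> = l powr s + A / l * mean (Suc k) (\<lambda>w. \<bar>g w - a\<bar>) v"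
      using card_I_pos unfolding sum.distrib sum_distrib_left[symmetric] by (simp add: add_divide_distrib)
    finally show ?thesis by (simp add: A_def)
  next
    case False
    have "mean (Suc k) (\<lambda>w. \<bar>g w - a\<bar> powr s) v
        \<le> mean (Suc k) (\<lambda>w. 2 powr s * (\<bar>g w - g v\<bar> powr s + (l + c) powr s)) v"
    proof (rule mean_mono)
      fix w
      have "\<bar>g w - a\<bar> powr s \<le> (\<bar>g w - g v\<bar> + (l + c)) powr s"
        using Suc.prems(3) s by (intro powr_mono2) auto
      also have "\<dots> \<le> 2 powr s * (\<bar>g w - g v\<bar> powr s + (l + c) powr s)"
        using s l by (intro powr_sum_le) auto
      finally show "\<bar>g w - a\<bar> powr s \<le> 2 powr s * (\<bar>g w - g v\<bar> powr s + (l + c) powr s)" .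
    qed
    also have "\<dots> = 2 powr s * (mean (Suc k) (\<lambda>w. \<bar>g w - g v\<bar> powr s) v + (l + c) powr s)"
      by (simp only: mean_cmult mean_add mean_const)
    also have "\<dots> \<le> A"
      unfolding A_def by (intro mult_left_mono add_right_mono Suc.prems(1) Suc.prems(2)) auto
    also have "\<dots> = A / l * l"
      using l by simp
    also have "\<dots> \<le> A / l * mean (Suc k) (\<lambda>w. \<bar>g w - a\<bar>) v"
      using False l M abs_diff_le_mean[OF g Suc.prems(2), of a "Suc k"]
      by (intro mult_left_mono) (auto simp: A_def)
    finally show ?thesis
      unfolding A_def by (intro add_increasing) auto
  qed
qed

text \<open>The John-Nirenberg inequality for trees. With \<open>l = 2 powr (s + 1) * K\<close> the cut nodes weigh so
  little that the estimate for fewer generations reproduces itself. As only finitely many generations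
  occur at a time, the induction does not presuppose that the powers are integrable.\<close>
lemma power_oscillation_le:
  assumes g: "harmonic g" and s: "0 \<le> s" and K: "0 < K"
    and osc: "\<And>k v. node v \<Longrightarrow> mean k (\<lambda>w. \<bar>g w - g v\<bar>) v \<le> K"
    and v: "node v"
  shows "mean k (\<lambda>w. \<bar>g w - g v\<bar> powr s) v
    \<le> (2 * (2 powr (s + 1)) powr s + (2 powr (s + 1) + card I) powr s) * K powr s"
proof -
  define l c where "l = 2 powr (s + 1) * K" and "c = card I * K"
  (* M is the solution of M = l powr s + (M + (l + c) powr s) / 2. *)
  define M where "M = 2 * l powr s + (l + c) powr s"
  have l: "0 < l" and c: "0 \<le> c" and M: "0 \<le> M"
    using K unfolding l_def c_def M_def by (auto intro!: add_nonneg_nonneg mult_nonneg_nonneg)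
  have step: "\<bar>g (child i v) - g v\<bar> \<le> c" if node: "node v" and i: "i \<in> I" for v i
  proof -
    let ?S = "\<Sum>i\<in>I. \<bar>g (child i v) - g v\<bar>"
    have "?S / card I \<le> K"
      using osc[OF node, of 1] by simp
    then have "?S \<le> c"
      using card_I_pos by (simp add: c_def pos_divide_le_eq mult.commute)
    moreover have "\<bar>g (child i v) - g v\<bar> \<le> ?S"
      using i finite_I by (intro member_le_sum[of i I "\<lambda>i. \<bar>g (child i v) - g v\<bar>"]) auto
    ultimately show ?thesis by linarith
  qed
  have "mean k (\<lambda>w. \<bar>g w - g v\<bar> powr s) v \<le> M"
    using v
  proof (induction k arbitrary: v rule: less_induct)
    case (less k v)
    show ?case
    proof (cases k)
      case 0
      then show ?thesis using M by simp
    next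
      case (Suc j)
      define A where "A = 2 powr s * (M + (l + c) powr s) / l"
      have "mean j (\<lambda>w. \<bar>g w - g v\<bar> powr s) (child i v)
          \<le> l powr s + A * mean j (\<lambda>w. \<bar>g w - g v\<bar>) (child i v)" if i: "i \<in> I" for i
        unfolding A_def
      proof (rule stopping_estimate[OF g s l c M step])
        show "mean j' (\<lambda>w. \<bar>g w - g u\<bar> powr s) u \<le> M" if "j' \<le> j" "node u" for j' u
          using less.IH[of j' u] Suc that by simp
        show "\<bar>g (child i v) - g v\<bar> \<le> l + c"
          using step[OF less.prems i] l by linarith
      qed (use less.prems i node_child in auto)
      then have "mean k (\<lambda>w. \<bar>g w - g v\<bar> powr s) v
          \<le> (\<Sum>i\<in>I. l powr s + A * mean j (\<lambda>w. \<bar>g w - g v\<bar>) (child i v)) / card I"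
        using card_I_pos by (auto simp: Suc intro!: divide_right_mono sum_mono)
      also have "\<dots> = l powr s + A * mean k (\<lambda>w. \<bar>g w - g v\<bar>) v"
        using card_I_pos by (simp add: Suc sum.distrib add_divide_distrib flip: sum_distrib_left)
      also have "\<dots> \<le> l powr s + A * K"
        using l M by (intro add_left_mono mult_left_mono osc less.prems) (auto simp: A_def)
      also have "A * K = (M + (l + c) powr s) / 2"
      proof -
        have 1: "2 powr s * K / l = 1 / 2"
          using K by (simp add: l_def powr_add)
        have 2: "A * K = (2 powr s * K / l) * (M + (l + c) powr s)"
          by (simp add: A_def)
        show ?thesis unfolding 2 1 by simp
      qed
      also have "l powr s + (M + (l + c) powr s) / 2 = M"
        by (simp add: M_def)
      finally show ?thesis .
    qed
  qed
  also have "M = (2 * (2 powr (s + 1)) powr s + (2 powr (s + 1) + card I) powr s) * K powr s"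
  proof -
    have "l + c = (2 powr (s + 1) + card I) * K"
      by (simp add: l_def c_def distrib_right)
    then have 1: "(l + c) powr s = (2 powr (s + 1) + card I) powr s * K powr s"
      using K by (simp only: powr_mult)
    have 2: "l powr s = (2 powr (s + 1)) powr s * K powr s"
      using K unfolding l_def by (simp only: powr_mult)
    show ?thesis
      unfolding M_def 1 2 by (simp only: distrib_right mult.assoc)
  qed
  finally show ?thesis .
qed

end

section \<open>Dyadic subcubes\<close>

lemma mem_cube: "y \<in> cube x r \<longleftrightarrow> (\<forall>b\<in>Basis. \<bar>(y - x) \<bullet> b\<bar> \<le> r / 2)"
  unfolding cube_def mem_box abs_le_iff
  by (intro ball_cong refl) (auto simp: inner_simps)

lemma cube_lmeasurable [simp, intro]: "cube x r \<in> lmeasurable"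
  by (simp add: cube_def)

lemma cube_sets [measurable, simp]: "cube x r \<in> sets lebesgue"
  by (simp add: cube_def)

lemma measure_cube: "0 \<le> r \<Longrightarrow> measure lebesgue (cube (x :: 'a::euclidean_space) r) = r ^ DIM('a)"
  by (simp add: cube_def content_cbox inner_simps)

lemma emeasure_cube: "0 \<le> r \<Longrightarrow> emeasure lebesgue (cube (x :: 'a::euclidean_space) r) = ennreal (r ^ DIM('a))"
  by (metis cube_lmeasurable emeasure_eq_measure2 measure_cube)

lemma dist_cube:
  assumes "y \<in> cube x r" shows "dist y (x :: 'a::euclidean_space) \<le> real DIM('a) * r / 2"
proof -
  have "norm (y - x) \<le> (\<Sum>b\<in>Basis. \<bar>(y - x) \<bullet> b\<bar>)" by (rule norm_le_l1)
  also have "\<dots> \<le> (\<Sum>b\<in>(Basis::'a set). r / 2)" using assms by (intro sum_mono) (auto simp: mem_cube)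
  finally show ?thesis by (simp add: dist_norm)
qed

text \<open>A cube is represented by the pair of its centre and its side. The set \<open>S\<close> of basis vectors names
  the directions in which the subcube takes the upper half.\<close>
definition subcube :: "'a::euclidean_space set \<Rightarrow> 'a \<times> real \<Rightarrow> 'a \<times> real" where
  "subcube S v = (fst v + (snd v / 4) *\<^sub>R (2 *\<^sub>R \<Sum>S - One), snd v / 2)"

abbreviation cube_of :: "'a::euclidean_space \<times> real \<Rightarrow> 'a set" where
  "cube_of v \<equiv> cube (fst v) (snd v)"

lemma mem_subcube:
  fixes v :: "'a::euclidean_space \<times> real"
  assumes "S \<subseteq> Basis"
  shows "y \<in> cube_of (subcube S v) \<longleftrightarrow>
    (\<forall>b\<in>Basis. if b \<in> S then 0 \<le> (y - fst v) \<bullet> b \<and> (y - fst v) \<bullet> b \<le> snd v / 2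
                     else - (snd v / 2) \<le> (y - fst v) \<bullet> b \<and> (y - fst v) \<bullet> b \<le> 0)"
proof -
  have fin: "finite S" using assms finite_Basis finite_subset by blast
  have sum: "\<Sum>S \<bullet> b = (if b \<in> S then 1 else 0)" if "b \<in> Basis" for b
  proof -
    have "\<Sum>S \<bullet> b = (\<Sum>c\<in>S. if c = b then 1 else 0)"
      using assms that by (auto simp: inner_sum_left inner_Basis intro!: sum.cong)
    then show ?thesis using fin by simp
  qed
  show ?thesis
    unfolding mem_cube subcube_def abs_le_iff
    by (intro ball_cong refl) (auto simp: inner_simps sum algebra_simps)
qed

lemma cube_subset_subcube: "S \<subseteq> Basis \<Longrightarrow> 0 \<le> snd v \<Longrightarrow> cube_of (subcube S v) \<subseteq> cube_of v"
proof
  fix y assume S: "S \<subseteq> Basis" and r: "0 \<le> snd v" and y: "y \<in> cube_of (subcube S v)"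
  have "\<bar>(y - fst v) \<bullet> b\<bar> \<le> snd v / 2" if "b \<in> Basis" for b
    using y[unfolded mem_subcube[OF S], rule_format, OF that] r
    by (cases "b \<in> S") (simp_all only: if_True if_False, linarith+)
  then show "y \<in> cube_of v" by (simp add: mem_cube)
qed

text \<open>The subcubes overlap only in the hyperplanes that bisect the cube.\<close>
lemma indicator_cube_eq_sum_AE:
  fixes v :: "'a::euclidean_space \<times> real"
  assumes "0 \<le> snd v"
  shows "AE y in lebesgue. indicator (cube_of v) y = (\<Sum>S\<in>Pow Basis. indicator (cube_of (subcube S v)) y :: real)"
proof -
  define N where "N = (\<Union>b\<in>Basis. {y. y \<bullet> b = fst v \<bullet> b})"
  have "negligible N"
    unfolding N_def using negligible_standard_hyperplane by (intro negligible_Union) (auto simp: inner_commute)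
  then have "N \<in> null_sets lebesgue"
    by (simp add: negligible_iff_null_sets)
  moreover have "{y \<in> space lebesgue. indicator (cube_of v) y \<noteq> (\<Sum>S\<in>Pow Basis. indicator (cube_of (subcube S v)) y :: real)} \<subseteq> N"
  proof (intro subsetI, rule ccontr)
    fix y assume yN: "y \<notin> N"
      and neq: "y \<in> {y \<in> space lebesgue. indicator (cube_of v) y \<noteq> (\<Sum>S\<in>Pow Basis. indicator (cube_of (subcube S v)) y :: real)}"
    define T where "T = {b \<in> Basis. 0 < (y - fst v) \<bullet> b}"
    have nz: "(y - fst v) \<bullet> b \<noteq> 0" if "b \<in> Basis" for b
      using yN that by (auto simp: N_def inner_simps)
    have "y \<in> cube_of (subcube S v) \<longleftrightarrow> S = T \<and> y \<in> cube_of v" if S: "S \<subseteq> Basis" for S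
    proof
      assume y: "y \<in> cube_of (subcube S v)"
      have "b \<in> S \<longleftrightarrow> b \<in> T" if "b \<in> Basis" for b
        using y[unfolded mem_subcube[OF S], rule_format, OF that] nz[OF that] that
        unfolding T_def by (cases "b \<in> S") (simp_all del: inner_diff_left)
      then have "S = T" using S by (auto simp: T_def)
      then show "S = T \<and> y \<in> cube_of v"
        using y cube_subset_subcube[OF S assms] by blast
    next
      assume y: "S = T \<and> y \<in> cube_of v"
      show "y \<in> cube_of (subcube S v)"
        unfolding mem_subcube[OF S]
      proof
        fix b :: 'a assume b: "b \<in> Basis"
        have "\<bar>(y - fst v) \<bullet> b\<bar> \<le> snd v / 2"
          using y b by (simp add: mem_cube)
        moreover have "b \<in> S \<longleftrightarrow> 0 < (y - fst v) \<bullet> b"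
          using y b by (simp add: T_def)
        ultimately show "if b \<in> S then 0 \<le> (y - fst v) \<bullet> b \<and> (y - fst v) \<bullet> b \<le> snd v / 2
            else - (snd v / 2) \<le> (y - fst v) \<bullet> b \<and> (y - fst v) \<bullet> b \<le> 0"
          by (cases "b \<in> S"; simp del: inner_diff_left; linarith)
      qed
    qed
    then have "(\<Sum>S\<in>Pow Basis. indicator (cube_of (subcube S v)) y :: real)
        = (\<Sum>S\<in>Pow Basis. if S = T then indicator (cube_of v) y else 0)"
      by (intro sum.cong) (auto simp: indicator_def)
    also have "\<dots> = indicator (cube_of v) y"
      by (simp add: T_def)
    finally show False using neq by simp
  qed
  ultimately show ?thesis by (rule AE_I')
qed

lemma avg_eq_mean_subcubes:
  fixes v :: "'a::euclidean_space \<times> real"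
  assumes r: "0 < snd v" and f: "set_integrable lebesgue (cube_of v) f"
  shows "avg (cube_of v) f = (\<Sum>S\<in>Pow Basis. avg (cube_of (subcube S v)) f) / card (Pow (Basis :: 'a set))"
proof -
  have int: "set_integrable lebesgue (cube_of (subcube S v)) f" if "S \<in> Pow Basis" for S
    using that r by (intro set_integrable_subset[OF f] cube_subset_subcube) auto
  have fi: "integrable lebesgue (\<lambda>y. indicator (cube_of v) y * f y)"
    using f by (simp add: set_integrable_def)
  have si: "integrable lebesgue (\<lambda>y. \<Sum>S\<in>Pow Basis. indicator (cube_of (subcube S v)) y * f y)"
    using int by (intro Bochner_Integration.integrable_sum) (simp add: set_integrable_def)
  have "set_lebesgue_integral lebesgue (cube_of v) f
      = (\<integral>y. (\<Sum>S\<in>Pow Basis. indicator (cube_of (subcube S v)) y * f y) \<partial>lebesgue)"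
    unfolding set_lebesgue_integral_def real_scaleR_def
  proof (intro integral_cong_AE borel_measurable_integrable fi si)
    show "AE y in lebesgue. indicator (cube_of v) y * f y
        = (\<Sum>S\<in>Pow Basis. indicator (cube_of (subcube S v)) y * f y)"
      using indicator_cube_eq_sum_AE[of v] r
      by (auto elim!: eventually_mono simp flip: sum_distrib_right)
  qed
  also have "\<dots> = (\<Sum>S\<in>Pow Basis. set_lebesgue_integral lebesgue (cube_of (subcube S v)) f)"
    unfolding set_lebesgue_integral_def real_scaleR_def
    using int by (intro Bochner_Integration.integral_sum) (simp add: set_integrable_def)
  finally show ?thesis
    using r by (simp add: avg_def measure_cube subcube_def card_Pow power_divide sum_divide_distrib mult.commute)
qed

section \<open>Averages and continuous approximation\<close>

text \<open>A measurable function is almost everywhere the limit of continuous functions. Clamping \<open>f\<close> and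
  these functions to a large interval turns this into convergence in \<open>L\<^sup>1\<close> by dominated convergence.\<close>
lemma approx_continuous_L1:
  fixes f :: "'a::euclidean_space \<Rightarrow> real"
  assumes f: "set_integrable lebesgue A f" and A: "A \<in> lmeasurable" and e: "0 < e"
  obtains \<phi> where "continuous_on UNIV \<phi>" "set_integrable lebesgue A \<phi>"
    "(LINT x:A|lebesgue. \<bar>f x - \<phi> x\<bar>) < e"
proof -
  define F where "F = (\<lambda>x. indicator A x * f x)"
  have F: "integrable lebesgue F"
    using f by (simp add: set_integrable_def F_def)
  have [measurable]: "A \<in> sets lebesgue" "F \<in> borel_measurable lebesgue"
    using A F by auto
  define clamp :: "nat \<Rightarrow> real \<Rightarrow> real" where "clamp n t = max (- real n) (min (real n) t)" for n t
  have clamp_cont: "continuous_on UNIV (clamp n)" for n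
    unfolding clamp_def by (intro continuous_intros)
  have clamp_le: "\<bar>clamp n t\<bar> \<le> real n" for n t
    by (auto simp: clamp_def)
  have clamp0 [simp]: "clamp n 0 = 0" for n
    by (simp add: clamp_def)
  have [measurable]: "clamp n \<in> borel_measurable borel" for n
    using clamp_cont by (rule borel_measurable_continuous_onI)
  have "(\<lambda>n. \<integral>x. \<bar>F x - clamp n (F x)\<bar> \<partial>lebesgue) \<longlonglongrightarrow> (\<integral>x. 0 \<partial>(lebesgue :: 'a measure))"
  proof (rule integral_dominated_convergence[where w = "\<lambda>x. \<bar>F x\<bar>"])
    show "AE x in lebesgue. (\<lambda>n. \<bar>F x - clamp n (F x)\<bar>) \<longlonglongrightarrow> 0"
    proof (intro AE_I2 tendsto_eventually)
      fix x
      obtain m where "\<bar>F x\<bar> \<le> real m" using real_arch_simple by blast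
      then show "\<forall>\<^sub>F n in sequentially. \<bar>F x - clamp n (F x)\<bar> = 0"
        by (intro eventually_sequentiallyI[of m]) (auto simp: clamp_def)
    qed
  qed (use F in \<open>auto simp: clamp_def\<close>)
  then have "\<forall>\<^sub>F n in sequentially. (\<integral>x. \<bar>F x - clamp n (F x)\<bar> \<partial>lebesgue) < e / 2"
    using e by (intro order_tendstoD) auto
  then obtain m where m: "(\<integral>x. \<bar>F x - clamp m (F x)\<bar> \<partial>lebesgue) < e / 2"
    by (auto simp: eventually_sequentially)
  have "F measurable_on UNIV"
    by (intro lebesgue_measurable_imp_measurable_on_real) auto
  then obtain N g where N: "negligible N" and g: "\<And>n. continuous_on UNIV (g n)"
    and lim: "\<And>x. x \<notin> N \<Longrightarrow> (\<lambda>n. g n x :: real) \<longlonglongrightarrow> F x"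
    by (auto simp: measurable_on_def)
  have cont: "continuous_on UNIV (\<lambda>x. clamp m (g n x))" for n
    using continuous_on_compose2[OF clamp_cont g] by simp
  have [measurable]: "(\<lambda>x. clamp m (g n x)) \<in> borel_measurable lebesgue" for n
    using borel_measurable_continuous_onI[OF cont] by (simp add: measurable_completion)
  have intm: "integrable lebesgue (\<lambda>x. indicator A x * real m)"
    using A by (simp add: lmeasurable_iff_integrable)
  have si: "set_integrable lebesgue A (\<lambda>x. clamp m (g n x))" for n
    unfolding set_integrable_def
    by (rule Bochner_Integration.integrable_bound[OF intm]) (use clamp_le in \<open>auto simp: indicator_def\<close>)
  have iclamp: "integrable lebesgue (\<lambda>x. clamp m (F x))"
    by (rule Bochner_Integration.integrable_bound[OF F]) (auto simp: clamp_def)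
  have "(\<lambda>n. \<integral>x. \<bar>clamp m (F x) - indicator A x * clamp m (g n x)\<bar> \<partial>lebesgue)
      \<longlonglongrightarrow> (\<integral>x. 0 \<partial>(lebesgue :: 'a measure))"
  proof (rule integral_dominated_convergence[where w = "\<lambda>x. 2 * (indicator A x * real m)"])
    have "N \<in> null_sets lebesgue" using N by (simp add: negligible_iff_null_sets)
    then show "AE x in lebesgue. (\<lambda>n. \<bar>clamp m (F x) - indicator A x * clamp m (g n x)\<bar>) \<longlonglongrightarrow> 0"
    proof (rule AE_I'[OF _ subsetI], rule_tac ccontr)
      fix x assume x: "x \<notin> N" and
        nl: "x \<in> {x \<in> space lebesgue. \<not> (\<lambda>n. \<bar>clamp m (F x) - indicator A x * clamp m (g n x)\<bar>) \<longlonglongrightarrow> 0}"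
      have "(\<lambda>n. clamp m (g n x)) \<longlonglongrightarrow> clamp m (F x)"
        unfolding clamp_def by (intro tendsto_intros lim x)
      then have "(\<lambda>n. \<bar>clamp m (F x) - indicator A x * clamp m (g n x)\<bar>) \<longlonglongrightarrow>
          \<bar>clamp m (F x) - indicator A x * clamp m (F x)\<bar>"
        by (intro tendsto_intros)
      also have "\<bar>clamp m (F x) - indicator A x * clamp m (F x)\<bar> = 0"
        by (auto simp: F_def indicator_def)
      finally show False using nl by simp
    qed
    show "AE x in lebesgue. norm \<bar>clamp m (F x) - indicator A x * clamp m (g n x)\<bar> \<le> 2 * (indicator A x * real m)" for n
    proof (rule AE_I2)
      fix x
      show "norm \<bar>clamp m (F x) - indicator A x * clamp m (g n x)\<bar> \<le> 2 * (indicator A x * real m)"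
        using clamp_le[of m "F x"] clamp_le[of m "g n x"] by (auto simp: F_def indicator_def)
    qed
  qed (use intm in auto)
  then have "\<forall>\<^sub>F n in sequentially. (\<integral>x. \<bar>clamp m (F x) - indicator A x * clamp m (g n x)\<bar> \<partial>lebesgue) < e / 2"
    using e by (intro order_tendstoD) auto
  then obtain n where n: "(\<integral>x. \<bar>clamp m (F x) - indicator A x * clamp m (g n x)\<bar> \<partial>lebesgue) < e / 2"
    by (auto simp: eventually_sequentially)
  have si': "integrable lebesgue (\<lambda>x. indicator A x * clamp m (g n x))"
    using si by (simp add: set_integrable_def)
  have "(LINT x:A|lebesgue. \<bar>f x - clamp m (g n x)\<bar>) = (\<integral>x. \<bar>F x - indicator A x * clamp m (g n x)\<bar> \<partial>lebesgue)"
    unfolding set_lebesgue_integral_def by (intro Bochner_Integration.integral_cong) (auto simp: F_def indicator_def)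
  also have "\<dots> \<le> (\<integral>x. \<bar>F x - clamp m (F x)\<bar> + \<bar>clamp m (F x) - indicator A x * clamp m (g n x)\<bar> \<partial>lebesgue)"
    using F iclamp si' by (intro integral_mono) auto
  also have "\<dots> < e"
    using m n F iclamp si' by (subst Bochner_Integration.integral_add) auto
  finally show ?thesis
    using that cont si by blast
qed

lemma set_integrable_const: "A \<in> lmeasurable \<Longrightarrow> set_integrable lebesgue A (\<lambda>x. c :: real)"
  by (simp add: set_integrable_def lmeasurable_iff_integrable)

lemma avg_add: "set_integrable lebesgue A f \<Longrightarrow> set_integrable lebesgue A g \<Longrightarrow>
    avg A (\<lambda>x. f x + g x) = avg A f + avg A g"
  by (simp add: avg_def set_integral_add add_divide_distrib)

lemma avg_diff: "set_integrable lebesgue A f \<Longrightarrow> set_integrable lebesgue A g \<Longrightarrow>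
    avg A (\<lambda>x. f x - g x) = avg A f - avg A g"
  by (simp add: avg_def set_integral_diff diff_divide_distrib)

lemma avg_cmult: "avg A (\<lambda>x. c * f x) = c * avg A f"
  by (simp add: avg_def)

lemma avg_const: "0 < measure lebesgue A \<Longrightarrow> A \<in> lmeasurable \<Longrightarrow> avg A (\<lambda>x. c) = c"
  by (simp add: avg_def set_lebesgue_integral_def fmeasurableD)

lemma avg_mono: "set_integrable lebesgue A f \<Longrightarrow> set_integrable lebesgue A g \<Longrightarrow>
    (\<And>x. x \<in> A \<Longrightarrow> f x \<le> g x) \<Longrightarrow> avg A f \<le> avg A g"
  unfolding avg_def by (intro divide_right_mono set_integral_mono) auto

lemma set_integrable_abs_diff:
  fixes f :: "'a::euclidean_space \<Rightarrow> real"
  shows "set_integrable lebesgue A f \<Longrightarrow> set_integrable lebesgue A g \<Longrightarrow>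
    set_integrable lebesgue A (\<lambda>x. \<bar>f x - g x\<bar>)"
  by (intro set_integrable_abs set_integral_diff)

lemma abs_avg_diff_le:
  assumes A: "0 < measure lebesgue A" "A \<in> lmeasurable" and f: "set_integrable lebesgue A f"
  shows "\<bar>avg A f - a\<bar> \<le> avg A (\<lambda>x. \<bar>f x - a\<bar>)"
proof -
  note c = set_integrable_const[OF A(2)]
  have eq: "avg A f - a = avg A (\<lambda>x. f x - a)"
    by (simp add: avg_diff f c avg_const A)
  have "avg A (\<lambda>x. f x - a) \<le> avg A (\<lambda>x. \<bar>f x - a\<bar>)"
    by (intro avg_mono set_integral_diff(1) set_integrable_abs_diff f c) auto
  moreover have "avg A (\<lambda>x. -1 * (f x - a)) \<le> avg A (\<lambda>x. \<bar>f x - a\<bar>)"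
    by (intro avg_mono set_integrable_mult_right set_integral_diff(1) set_integrable_abs_diff f c) auto
  ultimately show ?thesis unfolding eq avg_cmult by linarith
qed

lemma nn_avg_eq_avg:
  assumes "set_integrable lebesgue A f" "\<And>x. 0 \<le> f x" "0 < measure lebesgue A" "A \<in> lmeasurable"
  shows "nn_avg A (\<lambda>x. ennreal (f x)) = ennreal (avg A f)"
proof -
  have "(\<integral>\<^sup>+x\<in>A. ennreal (f x) \<partial>lebesgue) = (\<integral>\<^sup>+x. ennreal (indicator A x * f x) \<partial>lebesgue)"
    by (intro nn_integral_cong) (auto simp: indicator_def)
  also have "\<dots> = ennreal (LINT x:A|lebesgue. f x)"
    using assms unfolding set_lebesgue_integral_def real_scaleR_def
    by (intro nn_integral_eq_integral) (auto simp: set_integrable_def)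
  finally show ?thesis
    using assms
    by (simp add: nn_avg_def avg_def emeasure_eq_measure2 divide_ennreal set_lebesgue_integral_def)
qed

section \<open>The John-Nirenberg inequality on cubes\<close>

definition inside :: "'a::euclidean_space set \<Rightarrow> 'a \<times> real \<Rightarrow> bool" where
  "inside Q v \<longleftrightarrow> 0 < snd v \<and> cube_of v \<subseteq> Q"

interpretation subcubes: averaging_tree subcube "Pow (Basis :: 'a::euclidean_space set)" "inside Q" for Q
proof
  fix v :: "'a \<times> real" and S :: "'a set"
  assume "inside Q v" "S \<in> Pow Basis"
  then show "inside Q (subcube S v)"
    using cube_subset_subcube[of S v] by (auto simp: inside_def subcube_def)
qed auto

lemma snd_descendant:
  "w \<in> subcubes.descendants k v \<Longrightarrow> snd w = snd v / 2 ^ k"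
  by (induction k arbitrary: v) (auto simp: subcube_def)

lemma inside_lmeasurable: "inside Q v \<Longrightarrow> 0 < measure lebesgue (cube_of v)"
  by (simp add: inside_def measure_cube)

lemma harmonic_avg:
  assumes "set_integrable lebesgue Q f"
  shows "subcubes.harmonic Q (\<lambda>v. avg (cube_of v) f)"
  unfolding subcubes.harmonic_def
proof (intro allI impI)
  fix v assume "inside Q v"
  then show "avg (cube_of v) f = (\<Sum>S\<in>Pow Basis. avg (cube_of (subcube S v)) f) / card (Pow (Basis :: 'a set))"
    using assms by (intro avg_eq_mean_subcubes) (auto simp: inside_def intro: set_integrable_subset)
qed

lemma set_integrable_Lipschitz:
  fixes f :: "'a::euclidean_space \<Rightarrow> real"
  assumes f [measurable]: "f \<in> borel_measurable lebesgue" "set_integrable lebesgue A f" and A: "A \<in> lmeasurable"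
    and h: "\<And>u v. \<bar>h u - h v\<bar> \<le> L * \<bar>u - v\<bar>"
  shows "set_integrable lebesgue A (\<lambda>x. h (f x))"
proof (rule set_integrable_bound)
  have "L-lipschitz_on UNIV h"
    using h h[of 1 0] by (intro lipschitz_onI) (auto simp: dist_real_def)
  then have "continuous_on UNIV h" by (rule lipschitz_on_continuous_on)
  then have [measurable]: "h \<in> borel_measurable borel" by (rule borel_measurable_continuous_onI)
  show "set_borel_measurable lebesgue A (\<lambda>x. h (f x))"
    using A unfolding set_borel_measurable_def by measurable
  show "set_integrable lebesgue A (\<lambda>x. \<bar>h 0\<bar> + L * \<bar>f x\<bar>)"
    by (intro set_integral_add(1) set_integrable_const A set_integrable_mult_right set_integrable_abs f)
  show "AE x in lebesgue. x \<in> A \<longrightarrow> norm (h (f x)) \<le> norm (\<bar>h 0\<bar> + L * \<bar>f x\<bar>)"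
  proof (intro AE_I2 impI)
    fix x show "norm (h (f x)) \<le> norm (\<bar>h 0\<bar> + L * \<bar>f x\<bar>)"
      using h[of "f x" 0] by simp
  qed
qed

text \<open>On average over the subcubes of side \<open>snd v / 2 ^ k\<close> the function \<open>f\<close> is close in \<open>L\<^sup>1\<close> to its
  mean values: for a continuous function this is uniform continuity, and continuous functions are dense.
  Composed with a Lipschitz function \<open>h\<close>, the means converge to the average of \<open>h \<circ> f\<close>. This takes the
  place of Lebesgue's differentiation theorem.\<close>
lemma avg_Lipschitz_le_if_means_le:
  fixes f :: "'a::euclidean_space \<Rightarrow> real"
  assumes v: "0 < snd v" and f: "f \<in> borel_measurable lebesgue" "set_integrable lebesgue (cube_of v) f"
    and h: "\<And>s t. \<bar>h s - h t\<bar> \<le> L * \<bar>s - t\<bar>" and L: "0 \<le> L"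
    and le: "\<And>k. subcubes.mean k (\<lambda>w. h (avg (cube_of w) f)) v \<le> M"
  shows "avg (cube_of v) (\<lambda>x. h (f x)) \<le> M"
proof (rule field_le_epsilon)
  fix e :: real assume e: "0 < e"
  let ?Q = "cube_of v"
  define \<delta> where "\<delta> = e / (4 * L + 1)"
  have \<delta>: "0 < \<delta>" "4 * L * \<delta> \<le> e"
    using e L by (auto simp: \<delta>_def field_simps)
  have pos: "0 < measure lebesgue ?Q" and v': "inside ?Q v"
    using v by (simp_all add: measure_cube inside_def)
  obtain \<phi> where \<phi>: "continuous_on UNIV \<phi>" "set_integrable lebesgue ?Q \<phi>"
    and "(LINT x:?Q|lebesgue. \<bar>f x - \<phi> x\<bar>) < \<delta> * measure lebesgue ?Q"
    using approx_continuous_L1[OF f(2) cube_lmeasurable, of "\<delta> * measure lebesgue ?Q"] \<delta> pos by auto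
  then have f\<phi>: "avg ?Q (\<lambda>x. \<bar>f x - \<phi> x\<bar>) \<le> \<delta>"
    using pos by (simp add: avg_def pos_divide_le_eq)
  have "compact ?Q" by (simp add: cube_def)
  then have "uniformly_continuous_on ?Q \<phi>"
    using \<phi>(1) by (intro compact_uniformly_continuous continuous_on_subset[OF \<phi>(1)]) auto
  then obtain \<eta> where \<eta>: "0 < \<eta>" "\<And>y z. y \<in> ?Q \<Longrightarrow> z \<in> ?Q \<Longrightarrow> dist z y < \<eta> \<Longrightarrow> dist (\<phi> z) (\<phi> y) < \<delta>"
    using \<delta>(1) unfolding uniformly_continuous_on_def by meson
  have "(\<lambda>k. DIM('a) * snd v / 2 * (1 / 2) ^ k) \<longlonglongrightarrow> DIM('a) * snd v / 2 * 0"
    by (intro tendsto_intros LIMSEQ_realpow_zero) auto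
  then have "\<forall>\<^sub>F k in sequentially. DIM('a) * snd v / 2 * (1 / 2) ^ k < \<eta>"
    using \<eta>(1) by (intro order_tendstoD(2)) auto
  then obtain k where k: "DIM('a) * snd v / 2 * (1 / 2) ^ k < \<eta>"
    by (auto simp: eventually_sequentially)
  have leaf: "avg (cube_of w) (\<lambda>x. h (f x))
      \<le> h (avg (cube_of w) f) + 2 * L * (avg (cube_of w) (\<lambda>x. \<bar>f x - \<phi> x\<bar>) + \<delta>)"
    if w: "w \<in> subcubes.descendants k v" for w
  proof -
    let ?W = "cube_of w" and ?g = "avg (cube_of w) f" and ?c = "\<phi> (fst w)"
    have inw: "inside ?Q w" using subcubes.node_descendant[OF v' w] .
    then have sub: "?W \<subseteq> ?Q" and posw: "0 < snd w" by (auto simp: inside_def)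
    note mW = inside_lmeasurable[OF inw] cube_lmeasurable[of "fst w" "snd w"]
    have fw: "set_integrable lebesgue ?W f" "set_integrable lebesgue ?W \<phi>"
      using f(2) \<phi>(2) sub by (auto intro: set_integrable_subset)
    note hw = set_integrable_Lipschitz[OF f(1) fw(1) mW(2) h]
    note cw = set_integrable_const[OF mW(2)]
    note aw = set_integrable_abs_diff[OF fw(1) fw(2)]
    note bw = set_integrable_abs_diff[OF fw(1) cw]
    have \<phi>c: "\<bar>\<phi> x - ?c\<bar> \<le> \<delta>" if "x \<in> ?W" for x
    proof -
      have "fst w \<in> ?W" using posw by (simp add: mem_cube)
      moreover have "real DIM('a) * snd w / 2 = DIM('a) * snd v / 2 * (1 / 2) ^ k"
        by (simp add: snd_descendant[OF w] power_one_over)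
      then have "dist x (fst w) < \<eta>"
        using dist_cube[OF that] k by linarith
      ultimately have "dist (\<phi> x) ?c < \<delta>"
        using sub that by (intro \<eta>(2)) auto
      then show ?thesis by (simp add: dist_real_def)
    qed
    have c: "avg ?W (\<lambda>x. \<bar>f x - ?c\<bar>) \<le> avg ?W (\<lambda>x. \<bar>f x - \<phi> x\<bar>) + \<delta>"
    proof -
      have "avg ?W (\<lambda>x. \<bar>f x - ?c\<bar>) \<le> avg ?W (\<lambda>x. \<bar>f x - \<phi> x\<bar> + \<delta>)"
      proof (intro avg_mono bw set_integral_add(1) aw cw)
        fix x assume "x \<in> ?W"
        then show "\<bar>f x - ?c\<bar> \<le> \<bar>f x - \<phi> x\<bar> + \<delta>" using \<phi>c[of x] by linarith
      qed
      then show ?thesis by (simp add: avg_add aw cw avg_const mW)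
    qed
    have "avg ?W (\<lambda>x. h (f x)) \<le> avg ?W (\<lambda>x. h ?g + L * (\<bar>f x - ?c\<bar> + \<bar>?g - ?c\<bar>))"
    proof (intro avg_mono hw set_integral_add(1) set_integrable_mult_right bw cw)
      fix x
      have "h (f x) \<le> h ?g + L * \<bar>f x - ?g\<bar>" using h[of "f x" ?g] by linarith
      also have "L * \<bar>f x - ?g\<bar> \<le> L * (\<bar>f x - ?c\<bar> + \<bar>?g - ?c\<bar>)"
        by (intro mult_left_mono L) linarith
      finally show "h (f x) \<le> h ?g + L * (\<bar>f x - ?c\<bar> + \<bar>?g - ?c\<bar>)" by simp
    qed
    also have "\<dots> = h ?g + L * (avg ?W (\<lambda>x. \<bar>f x - ?c\<bar>) + \<bar>?g - ?c\<bar>)"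
      by (simp only: avg_add[OF cw set_integrable_mult_right[OF set_integral_add(1)[OF bw cw]]]
          avg_cmult avg_add[OF bw cw] avg_const mW)
    also have "\<dots> \<le> h ?g + L * (2 * avg ?W (\<lambda>x. \<bar>f x - ?c\<bar>))"
      using abs_avg_diff_le[OF mW fw(1), of ?c] by (intro add_left_mono mult_left_mono L) linarith
    also have "\<dots> \<le> h ?g + L * (2 * (avg ?W (\<lambda>x. \<bar>f x - \<phi> x\<bar>) + \<delta>))"
      using c by (intro add_left_mono mult_left_mono L) simp_all
    finally show ?thesis by (simp add: mult.assoc mult.left_commute)
  qed
  have "avg ?Q (\<lambda>x. h (f x)) = subcubes.mean k (\<lambda>w. avg (cube_of w) (\<lambda>x. h (f x))) v"
    using subcubes.mean_harmonic[OF harmonic_avg[OF set_integrable_Lipschitz[OF f cube_lmeasurable h]] v'] by simp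
  also have "\<dots> \<le> subcubes.mean k (\<lambda>w. h (avg (cube_of w) f) + 2 * L * (avg (cube_of w) (\<lambda>x. \<bar>f x - \<phi> x\<bar>) + \<delta>)) v"
    by (rule subcubes.mean_mono[OF leaf])
  also have "\<dots> = subcubes.mean k (\<lambda>w. h (avg (cube_of w) f)) v + 2 * L * (avg ?Q (\<lambda>x. \<bar>f x - \<phi> x\<bar>) + \<delta>)"
    using subcubes.mean_harmonic[OF harmonic_avg[OF set_integrable_abs_diff[OF f(2) \<phi>(2)]] v', of k]
    by (simp only: subcubes.mean_add subcubes.mean_cmult subcubes.mean_const)
  also have "\<dots> \<le> M + 2 * L * (\<delta> + \<delta>)"
    using f\<phi> L by (intro add_mono le mult_left_mono) auto
  also have "\<dots> \<le> M + e" using \<delta>(2) by (simp add: algebra_simps)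
  finally show "avg ?Q (\<lambda>x. h (f x)) \<le> M + e" .
qed

text \<open>The graph of a convex function lies above its tangent at \<open>v\<close>; for powers this is Young's
  inequality.\<close>
lemma powr_tangent:
  fixes u v s :: real
  assumes "0 \<le> u" "0 \<le> v" "1 < s"
  shows "v powr s - u powr s \<le> s * v powr (s - 1) * (v - u)"
proof (cases "v = 0")
  case False
  have *: "1 / s + 1 / (s / (s - 1)) = 1"
    using assms by (simp add: field_simps)
  have "u * v powr (s - 1) \<le> u powr s / s + (v powr (s - 1)) powr (s / (s - 1)) / (s / (s - 1))"
    using Youngs_inequality[OF _ _ *, of u "v powr (s - 1)"] assms by simp
  also have "(v powr (s - 1)) powr (s / (s - 1)) = v powr s"
    using assms by (simp add: powr_powr)
  finally have 1: "s * (u * v powr (s - 1)) \<le> u powr s + (s - 1) * v powr s"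
    using assms by (simp add: field_simps)
  have 2: "v powr s = v powr (s - 1) * v"
    using False assms by (simp add: powr_mult_base[symmetric] mult.commute powr_diff)
  have 3: "s * v powr (s - 1) * (v - u) = s * v powr s - s * (u * v powr (s - 1))"
    unfolding 2 by (simp add: algebra_simps)
  show ?thesis unfolding 3 using 1 by (simp add: left_diff_distrib)
qed (use assms in simp)

lemma truncated_powr_Lipschitz:
  fixes a N s t u :: real
  assumes "0 \<le> N" "1 < s"
  shows "\<bar>min \<bar>t - a\<bar> N powr s - min \<bar>u - a\<bar> N powr s\<bar> \<le> s * N powr (s - 1) * \<bar>t - u\<bar>"
proof -
  have *: "min \<bar>t - a\<bar> N powr s - min \<bar>u - a\<bar> N powr s \<le> s * N powr (s - 1) * \<bar>t - u\<bar>" for t u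
  proof (cases "min \<bar>t - a\<bar> N \<le> min \<bar>u - a\<bar> N")
    case True
    then have "min \<bar>t - a\<bar> N powr s \<le> min \<bar>u - a\<bar> N powr s"
      using assms by (intro powr_mono2) auto
    then show ?thesis using assms by (intro order_trans[OF _ mult_nonneg_nonneg]) auto
  next
    case False
    have "min \<bar>t - a\<bar> N powr s - min \<bar>u - a\<bar> N powr s
        \<le> s * min \<bar>t - a\<bar> N powr (s - 1) * (min \<bar>t - a\<bar> N - min \<bar>u - a\<bar> N)"
      using assms by (intro powr_tangent) auto
    also have "\<dots> \<le> s * N powr (s - 1) * \<bar>t - u\<bar>"
      using assms False by (intro mult_mono powr_mono2) auto
    finally show ?thesis .
  qed
  show ?thesis using *[of t u] *[of u t] by (simp add: abs_le_iff abs_minus_commute)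
qed

text \<open>The factor obtained for trees, with the \<open>2 ^ d\<close> dyadic subcubes of a cube as children.\<close>
definition JN_const :: "real \<Rightarrow> nat \<Rightarrow> real" where
  "JN_const s d = 2 * (2 powr (s + 1)) powr s + (2 powr (s + 1) + 2 ^ d) powr s"

text \<open>The averages of \<open>f\<close> over the dyadic subcubes satisfy the hypotheses of the estimate for trees.
  Truncation keeps the powers integrable and Lipschitz, which the passage from the averages to \<open>f\<close>
  itself requires; monotone convergence then removes it.\<close>
theorem John_Nirenberg_cube:
  fixes f :: "'a::euclidean_space \<Rightarrow> real"
  assumes f [measurable]: "f \<in> borel_measurable lebesgue" and int: "set_integrable lebesgue (cube x r) f"
    and r: "0 < r" and s: "1 < s" and K: "0 < K"
    and osc: "\<And>y t. 0 < t \<Longrightarrow> cube y t \<subseteq> cube x r \<Longrightarrow>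
      nn_avg (cube y t) (\<lambda>z. ennreal \<bar>f z - avg (cube y t) f\<bar>) \<le> ennreal K"
  shows "nn_avg (cube x r) (\<lambda>z. ennreal (\<bar>f z - avg (cube x r) f\<bar> powr s))
    \<le> ennreal (JN_const s DIM('a) * K powr s)"
proof -
  let ?Q = "cube x r" and ?v = "(x, r)"
  define a where "a = avg ?Q f"
  define g where "g = (\<lambda>v. avg (cube_of v) f)"
  define h :: "nat \<Rightarrow> real \<Rightarrow> real" where "h n t = min \<bar>t - a\<bar> (real n) powr s" for n t
  have h_Lip: "\<bar>h n t - h n u\<bar> \<le> (s * real n powr (s - 1)) * \<bar>t - u\<bar>" for n t u
    unfolding h_def using s by (intro truncated_powr_Lipschitz) auto
  have in_v: "inside ?Q ?v"
    using r by (simp add: inside_def)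
  have pos: "0 < measure lebesgue ?Q"
    using r by (simp add: measure_cube)
  have harm: "subcubes.harmonic ?Q g"
    unfolding g_def by (rule harmonic_avg[OF int])
  have osc': "subcubes.mean k (\<lambda>w. \<bar>g w - g v\<bar>) v \<le> K" if v: "inside ?Q v" for k v
  proof -
    let ?W = "cube_of v"
    have W: "0 < measure lebesgue ?W" "?W \<in> lmeasurable" and sub: "?W \<subseteq> ?Q" and "0 < snd v"
      using v by (auto intro: inside_lmeasurable simp: inside_def)
    have intW: "set_integrable lebesgue ?W f"
      using int sub by (auto intro: set_integrable_subset)
    note intd = set_integrable_abs_diff[OF intW set_integrable_const[OF W(2), of "g v"]]
    have v': "inside ?W v" using v by (simp add: inside_def)
    have "subcubes.mean k (\<lambda>w. \<bar>g w - g v\<bar>) v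
        \<le> subcubes.mean k (\<lambda>w. avg (cube_of w) (\<lambda>z. \<bar>f z - g v\<bar>)) v"
    proof (rule subcubes.mean_mono)
      fix w assume "w \<in> subcubes.descendants k v"
      then have w: "inside ?W w" by (rule subcubes.node_descendant[OF v'])
      then show "\<bar>g w - g v\<bar> \<le> avg (cube_of w) (\<lambda>z. \<bar>f z - g v\<bar>)"
        unfolding g_def
        by (intro abs_avg_diff_le inside_lmeasurable[OF w] cube_lmeasurable set_integrable_subset[OF intW])
           (auto simp: inside_def)
    qed
    also have "\<dots> = avg ?W (\<lambda>z. \<bar>f z - g v\<bar>)"
      by (rule subcubes.mean_harmonic[OF harmonic_avg[OF intd] v'])
    also have "ennreal \<dots> \<le> ennreal K"
      using osc[OF \<open>0 < snd v\<close> sub] by (subst nn_avg_eq_avg[symmetric]) (auto simp: intd[unfolded g_def] W g_def)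
    then have "avg ?W (\<lambda>z. \<bar>f z - g v\<bar>) \<le> K"
      using K by (simp add: ennreal_le_iff)
    finally show ?thesis .
  qed
  define C where "C = JN_const s DIM('a) * K powr s"
  have C: "0 \<le> C" by (simp add: C_def JN_const_def)
  have means: "subcubes.mean k (\<lambda>w. \<bar>g w - g ?v\<bar> powr s) ?v \<le> C" for k
    using subcubes.power_oscillation_le[OF harm _ K osc' in_v, of s k] s
    by (simp add: C_def JN_const_def card_Pow)
  have trunc: "nn_avg ?Q (\<lambda>z. ennreal (h n (f z))) \<le> ennreal C" for n
  proof -
    have "avg (cube_of ?v) (\<lambda>z. h n (f z)) \<le> C"
    proof (rule avg_Lipschitz_le_if_means_le[OF _ f _ h_Lip])
      fix k
      have "subcubes.mean k (\<lambda>w. h n (avg (cube_of w) f)) ?v \<le> subcubes.mean k (\<lambda>w. \<bar>g w - g ?v\<bar> powr s) ?v"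
        using s by (intro subcubes.mean_mono) (auto simp: h_def g_def a_def intro!: powr_mono2)
      then show "subcubes.mean k (\<lambda>w. h n (avg (cube_of w) f)) ?v \<le> C"
        using means order_trans by blast
    qed (use r int s in auto)
    moreover have "set_integrable lebesgue ?Q (\<lambda>z. h n (f z))"
      by (rule set_integrable_Lipschitz[OF f int cube_lmeasurable h_Lip])
    ultimately show ?thesis
      using C pos by (subst nn_avg_eq_avg) (auto simp: h_def intro!: ennreal_leI)
  qed
  have SUP: "(SUP n. ennreal (h n t)) = ennreal (\<bar>t - a\<bar> powr s)" for t
  proof (rule antisym)
    show "(SUP n. ennreal (h n t)) \<le> ennreal (\<bar>t - a\<bar> powr s)"
      using s by (intro SUP_least ennreal_leI) (auto simp: h_def intro!: powr_mono2)
    obtain m where "\<bar>t - a\<bar> \<le> real m" using real_arch_simple by blast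
    then have "ennreal (\<bar>t - a\<bar> powr s) = ennreal (h m t)" by (simp add: h_def)
    then show "ennreal (\<bar>t - a\<bar> powr s) \<le> (SUP n. ennreal (h n t))"
      by (metis SUP_upper UNIV_I)
  qed
  have "(\<integral>\<^sup>+z\<in>?Q. ennreal (\<bar>f z - a\<bar> powr s) \<partial>lebesgue) = (\<integral>\<^sup>+z. (SUP n. ennreal (h n (f z)) * indicator ?Q z) \<partial>lebesgue)"
    by (intro nn_integral_cong) (simp add: SUP SUP_mult_right_ennreal[symmetric])
  also have "\<dots> = (SUP n. \<integral>\<^sup>+z\<in>?Q. ennreal (h n (f z)) \<partial>lebesgue)"
  proof (rule nn_integral_monotone_convergence_SUP)
    show "incseq (\<lambda>n z. ennreal (h n (f z)) * indicator ?Q z)"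
      using s by (intro incseq_SucI le_funI mult_right_mono ennreal_leI) (auto simp: h_def intro!: powr_mono2)
    show "(\<lambda>z. ennreal (h n (f z)) * indicator ?Q z) \<in> borel_measurable lebesgue" for n
      unfolding h_def by measurable
  qed
  finally have "nn_avg ?Q (\<lambda>z. ennreal (\<bar>f z - a\<bar> powr s)) = (SUP n. nn_avg ?Q (\<lambda>z. ennreal (h n (f z))))"
    by (simp add: nn_avg_def SUP_divide_ennreal)
  also have "\<dots> \<le> ennreal C"
    by (intro SUP_least trunc)
  finally show ?thesis by (simp add: a_def C_def)
qed

section \<open>Weighted oscillation of functions of bounded mean oscillation\<close>

lemma locally_integrable_measurable:
  fixes f :: "'a::euclidean_space \<Rightarrow> real"
  assumes "locally_integrable f"
  shows "f \<in> borel_measurable lebesgue"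
proof (rule borel_measurable_LIMSEQ_real)
  fix x :: 'a
  obtain m where m: "norm x \<le> real m" using real_arch_simple by blast
  show "(\<lambda>n. indicator (cball 0 (real n)) x *\<^sub>R f x) \<longlonglongrightarrow> f x"
    using m by (intro tendsto_eventually eventually_sequentiallyI[of m]) auto
next
  fix n
  have "set_integrable lebesgue (cball 0 (real n)) f"
    using assms by (simp add: locally_integrable_def)
  then show "(\<lambda>x. indicator (cball 0 (real n)) x *\<^sub>R f x) \<in> borel_measurable lebesgue"
    unfolding set_integrable_def by (rule borel_measurable_integrable)
qed

lemma locally_integrable_set_integrable:
  "locally_integrable f \<Longrightarrow> set_integrable lebesgue (cube x r) f"
  by (simp add: locally_integrable_def cube_def)

text \<open>Positivity of \<open>\<rho>\<close> is implicit in Shen's inequalities: at distances approaching \<open>- \<rho> x\<close> a negative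
  value \<open>\<rho> x\<close> would make the lower bound blow up while the upper one stays bounded.\<close>
lemma shen_exponent_pos:
  fixes \<rho> :: "'a::euclidean_space \<Rightarrow> real"
  assumes "shen_exponent \<rho> N0"
  shows "0 < \<rho> x"
proof (rule ccontr)
  assume neg: "\<not> 0 < \<rho> x"
  obtain C0 where N0: "0 < N0" and C0: "1 \<le> C0"
    and lo: "\<And>x y. 1 / C0 * (1 + norm (x - y) / \<rho> x) powr (- N0) \<le> \<rho> y / \<rho> x"
    and up: "\<And>x y. \<rho> y / \<rho> x \<le> C0 * (1 + norm (x - y) / \<rho> x) powr (N0 / (N0 + 1))"
    using assms unfolding shen_exponent_def by blast
  have "\<rho> x \<noteq> 0" using lo[of x x] C0 by auto
  with neg have neg: "\<rho> x < 0" by simp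
  define t where "t = (C0\<^sup>2 + 1) powr (- 1 / N0)"
  have t: "0 < t" "t \<le> 1"
    using N0 powr_mono[of "- 1 / N0" 0 "C0\<^sup>2 + 1"] by (simp_all add: t_def add_nonneg_pos less_imp_neq[symmetric])
  obtain b :: 'a where b: "b \<in> Basis" using nonempty_Basis by blast
  define y where "y = x + (- \<rho> x * (1 - t)) *\<^sub>R b"
  have "norm (x - y) = - \<rho> x * (1 - t)"
    using b neg t by (simp add: y_def abs_mult)
  then have "1 + norm (x - y) / \<rho> x = t"
    using neg by (simp add: field_simps)
  then have "1 / C0 * t powr (- N0) \<le> C0 * t powr (N0 / (N0 + 1))"
    using lo[of x y] up[of y x] by (metis order_trans)
  also have "\<dots> \<le> C0 * 1"
    using C0 t N0 by (intro mult_left_mono powr_le1) auto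
  finally have "t powr (- N0) \<le> C0\<^sup>2"
    using C0 by (simp add: field_simps power2_eq_square)
  moreover have "t powr (- N0) = C0\<^sup>2 + 1"
    using N0 by (simp add: t_def powr_powr add_nonneg_pos)
  ultimately show False by simp
qed

lemma side_le_of_cube_subset:
  assumes "cube y t \<subseteq> cube (x :: 'a::euclidean_space) r" "0 < t" "0 < r"
  shows "t \<le> r"
proof -
  have "measure lebesgue (cube y t) \<le> measure lebesgue (cube x r)"
    by (intro measure_mono_fmeasurable assms) auto
  then show ?thesis using assms by (simp add: measure_cube power_mono_iff)
qed

text \<open>The centre of a subcube is at distance at most \<open>DIM('a) * r / 2\<close> from \<open>x\<close>, and the lower bound in
  Shen's inequalities limits the decrease of \<open>\<rho>\<close> over such a distance.\<close>
lemma scale_of_subcube_le: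
  fixes \<rho> :: "'a::euclidean_space \<Rightarrow> real"
  assumes "shen_exponent \<rho> N0"
  obtains C where "1 \<le> C" "\<And>x r y t. 0 < r \<Longrightarrow> 0 < t \<Longrightarrow> cube y t \<subseteq> cube x r \<Longrightarrow>
    1 + t / \<rho> y \<le> C * (1 + r / \<rho> x) powr (N0 + 1)"
proof -
  obtain C0 where N0: "0 < N0" and C0: "1 \<le> C0"
    and lo: "\<And>x y. 1 / C0 * (1 + norm (x - y) / \<rho> x) powr (- N0) \<le> \<rho> y / \<rho> x"
    using assms unfolding shen_exponent_def by blast
  note pos = shen_exponent_pos[OF assms]
  let ?d = "real DIM('a)"
  have "1 + t / \<rho> y \<le> (1 + C0 * ?d powr N0) * (1 + r / \<rho> x) powr (N0 + 1)"
    if r: "0 < r" and t: "0 < t" and sub: "cube y t \<subseteq> cube x r" for x r y t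
  proof -
    define X where "X = 1 + r / \<rho> x"
    have X: "1 \<le> X" using r pos[of x] by (simp add: X_def)
    have d: "1 \<le> ?d" using DIM_positive[where 'a = 'a] by linarith
    have tr: "t \<le> r" using side_le_of_cube_subset[OF sub t r] .
    have "y \<in> cube x r" using sub t by (auto simp: mem_cube subset_eq)
    then have "norm (x - y) \<le> ?d * r / 2"
      using dist_cube by (metis dist_commute dist_norm)
    also have "\<dots> \<le> ?d * r" using r by simp
    finally have "1 + norm (x - y) / \<rho> x \<le> 1 + ?d * r / \<rho> x"
      using pos[of x] by (simp add: divide_right_mono)
    also have "\<dots> \<le> ?d * X" using d by (simp add: X_def distrib_left)
    finally have le: "1 + norm (x - y) / \<rho> x \<le> ?d * X" .
    have one: "1 \<le> 1 + norm (x - y) / \<rho> x"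
      using pos[of x] by simp
    define Y where "Y = (1 + norm (x - y) / \<rho> x) powr N0"
    have Y: "0 < Y" using one by (simp add: Y_def)
    have "1 / (C0 * Y) \<le> \<rho> y / \<rho> x"
      using lo[of x y] by (simp add: Y_def powr_minus divide_inverse)
    then have "\<rho> x / \<rho> y \<le> C0 * Y"
      using pos[of x] pos[of y] Y C0 by (simp add: field_simps)
    also have "Y \<le> (?d * X) powr N0"
      unfolding Y_def using le one N0 by (intro powr_mono2) auto
    finally have "\<rho> x / \<rho> y \<le> C0 * (?d * X) powr N0"
      using C0 by (simp add: mult_left_mono)
    moreover have "t / \<rho> x \<le> X"
      using tr pos[of x] divide_right_mono[of t r "\<rho> x"] by (simp add: X_def)
    ultimately have "(\<rho> x / \<rho> y) * (t / \<rho> x) \<le> C0 * (?d * X) powr N0 * X"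
      using pos[of x] pos[of y] t C0 by (intro mult_mono) auto
    also have "\<dots> = C0 * ?d powr N0 * X powr (N0 + 1)"
      using X by (simp add: powr_mult powr_add)
    also have "(\<rho> x / \<rho> y) * (t / \<rho> x) = t / \<rho> y"
      using pos[of x] pos[of y] by simp
    finally have "t / \<rho> y \<le> C0 * ?d powr N0 * X powr (N0 + 1)" .
    moreover have "1 \<le> X powr (N0 + 1)" using X N0 by (intro ge_one_powr_ge_zero) auto
    ultimately show ?thesis by (simp add: X_def distrib_right)
  qed
  then show ?thesis using C0 by (intro that[of "1 + C0 * ?d powr N0"]) auto
qed

lemma oscillation_le_bmo_norm:
  assumes "0 < t" "0 < \<rho> y"
  shows "nn_avg (cube y t) (\<lambda>z. ennreal \<bar>f z - avg (cube y t) f\<bar>)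
    \<le> ennreal ((1 + t / \<rho> y) powr \<theta>) * bmo_norm \<rho> \<theta> f"
proof -
  let ?a = "1 + t / \<rho> y" and ?o = "nn_avg (cube y t) (\<lambda>z. ennreal \<bar>f z - avg (cube y t) f\<bar>)"
  have a: "0 < ?a" using assms by (simp add: add_pos_pos)
  have "ennreal (?a powr (- \<theta>)) * ?o \<le> bmo_norm \<rho> \<theta> f"
    unfolding bmo_norm_def by (rule SUP_upper2[OF UNIV_I], rule SUP_upper2[of t]) (use assms in auto)
  then have "ennreal (?a powr \<theta>) * (ennreal (?a powr (- \<theta>)) * ?o) \<le> ennreal (?a powr \<theta>) * bmo_norm \<rho> \<theta> f"
    by (rule mult_left_mono) simp
  moreover have "ennreal (?a powr \<theta>) * ennreal (?a powr (- \<theta>)) = 1"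
    using a by (simp flip: ennreal_mult powr_add)
  ultimately show ?thesis by (simp flip: mult.assoc)
qed

text \<open>Splitting off the weight by Hoelder's inequality, with the exponent for which the reverse
  inequality holds, leaves a power of the oscillation of \<open>f\<close> alone. On the subcubes of \<open>cube x0 r\<close>
  the scale \<open>1 + t / \<rho> y\<close> is at most a power of \<open>1 + r / \<rho> x0\<close>, so that there \<open>f\<close> has ordinary bounded
  mean oscillation and the theorem of John and Nirenberg applies.\<close>
theorem weighted_osc_le_bmo_norm:
  fixes \<rho> \<omega> :: "'a::euclidean_space \<Rightarrow> real"
  assumes w [measurable]: "\<omega> \<in> borel_measurable lebesgue" and q: "1 < q" and \<theta>: "0 < \<theta>"
    and shen: "shen_exponent \<rho> N0" and rh: "rh_exponent \<rho> (\<lambda>x. \<omega> x powr q) \<eta>"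
  shows "\<exists>C>0. \<forall>f\<in>BMO \<rho> \<theta>. \<forall>x0. \<forall>r>0.
    weighted_osc q \<omega> f (cube x0 r)
      \<le> ennreal (C * (1 + r / \<rho> x0) powr ((N0 + 1) * \<theta> + \<eta> / q)) * bmo_norm \<rho> \<theta> f"
proof -
  note pos = shen_exponent_pos[OF shen]
  obtain C1 where C1: "1 \<le> C1" and scale: "\<And>x r y t. 0 < r \<Longrightarrow> 0 < t \<Longrightarrow> cube y t \<subseteq> cube x r \<Longrightarrow>
    1 + t / \<rho> y \<le> C1 * (1 + r / \<rho> x) powr (N0 + 1)"
    using scale_of_subcube_le[OF shen] by blast
  obtain \<epsilon> C2 where \<epsilon>: "0 < \<epsilon>" and C2: "0 < C2" and rh: "\<And>x0 r. 0 < r \<Longrightarrow>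
     ennpowr (nn_avg (cube x0 r) (\<lambda>x. ennreal ((\<omega> x powr q) powr (1 + \<epsilon>)))) (1 / (1 + \<epsilon>))
     \<le> ennreal C2 * nn_avg (cube x0 r) (\<lambda>x. ennreal (\<omega> x powr q)) * ennreal ((1 + r / \<rho> x0) powr \<eta>)"
    using rh unfolding rh_exponent_def by blast
  define \<sigma> \<tau> where "\<sigma> = 1 + \<epsilon>" and "\<tau> = \<sigma> / \<epsilon>"
  have \<sigma>\<tau>: "1 < \<tau>" "1 < \<sigma>" "1 / \<tau> + 1 / \<sigma> = 1"
    using \<epsilon> by (auto simp: \<sigma>_def \<tau>_def field_simps)
  define s where "s = q * \<tau>"
  have s: "1 < s" using q \<sigma>\<tau> less_1_mult by (simp add: s_def)
  define J where "J = JN_const s DIM('a)"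
  have J: "0 < J" unfolding J_def JN_const_def by (intro add_pos_nonneg mult_pos_pos) auto
  define C where "C = J powr (1 / s) * C2 powr (1 / q) * C1 powr \<theta>"
  have C: "0 < C" using J C2 C1 by (simp add: C_def)
  have "weighted_osc q \<omega> f (cube x0 r)
      \<le> ennreal (C * (1 + r / \<rho> x0) powr ((N0 + 1) * \<theta> + \<eta> / q)) * bmo_norm \<rho> \<theta> f"
    if f: "f \<in> BMO \<rho> \<theta>" and r: "0 < r" for f x0 r
  proof -
    let ?Q = "cube x0 r"
    have lf: "locally_integrable f" and fin: "bmo_norm \<rho> \<theta> f < \<infinity>"
      using f by (auto simp: BMO_def)
    have [measurable]: "f \<in> borel_measurable lebesgue"
      using lf by (rule locally_integrable_measurable)
    obtain N where N: "bmo_norm \<rho> \<theta> f = ennreal N" "0 \<le> N"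
      using fin by (cases "bmo_norm \<rho> \<theta> f") auto
    define X where "X = 1 + r / \<rho> x0"
    have X: "1 \<le> X" using r pos[of x0] by (simp add: X_def)
    define c where "c = C * X powr ((N0 + 1) * \<theta> + \<eta> / q)"
    have c: "0 < c" using C X by (simp add: c_def)
    define g where "g = (\<lambda>x. ennreal (\<bar>f x - avg ?Q f\<bar> powr q))"
    define W where "W = (\<lambda>x. ennreal (\<omega> x powr q))"
    have [measurable]: "g \<in> borel_measurable lebesgue" "W \<in> borel_measurable lebesgue"
      by (simp_all add: g_def W_def)
    (* The norm N may vanish, whereas the inequality of John and Nirenberg needs a positive bound. *)
    have bound: "weighted_osc q \<omega> f ?Q \<le> ennreal (c * K)" if K: "N < K" for K
    proof -
      define L where "L = (C1 * X powr (N0 + 1)) powr \<theta> * K"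
      have K0: "0 < K" using N K by simp
      then have L: "0 < L" using C1 X by (simp add: L_def)
      have JN: "nn_avg ?Q (\<lambda>x. ennpowr (g x) \<tau>) \<le> ennreal (J * L powr s)"
      proof -
        have "nn_avg (cube y t) (\<lambda>z. ennreal \<bar>f z - avg (cube y t) f\<bar>) \<le> ennreal L"
          if t: "0 < t" and sub: "cube y t \<subseteq> ?Q" for y t
        proof -
          have "(1 + t / \<rho> y) powr \<theta> \<le> (C1 * X powr (N0 + 1)) powr \<theta>"
            unfolding X_def using \<theta> t pos[of y] by (intro powr_mono2 scale[OF r t sub]) auto
          then have "ennreal ((1 + t / \<rho> y) powr \<theta>) * bmo_norm \<rho> \<theta> f \<le> ennreal L"
            using N K by (auto simp: L_def simp flip: ennreal_mult intro!: ennreal_leI mult_mono)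
          then show ?thesis
            using oscillation_le_bmo_norm[of t \<rho> y f \<theta>] t pos order_trans by blast
        qed
        then have "nn_avg ?Q (\<lambda>z. ennreal (\<bar>f z - avg ?Q f\<bar> powr s)) \<le> ennreal (J * L powr s)"
          unfolding J_def using lf
          by (intro John_Nirenberg_cube r s L locally_integrable_set_integrable) auto
        then show ?thesis by (simp add: g_def powr_powr s_def)
      qed
      define D where "D = (J * L powr s) powr (1 / \<tau>) * (C2 * X powr \<eta>)"
      have "nn_avg ?Q (\<lambda>x. g x * W x)
          \<le> ennpowr (nn_avg ?Q (\<lambda>x. ennpowr (g x) \<tau>)) (1 / \<tau>) * ennpowr (nn_avg ?Q (\<lambda>x. ennpowr (W x) \<sigma>)) (1 / \<sigma>)"
        using \<sigma>\<tau> by (intro Hoelder_nn_avg) auto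
      also have "\<dots> \<le> ennpowr (ennreal (J * L powr s)) (1 / \<tau>) * (ennreal C2 * nn_avg ?Q W * ennreal (X powr \<eta>))"
        using \<sigma>\<tau> JN rh[OF r, of x0]
        by (intro mult_mono ennpowr_mono) (auto simp: W_def X_def \<sigma>_def)
      also have "\<dots> = ennreal D * nn_avg ?Q W"
      proof -
        have "ennpowr (ennreal (J * L powr s)) (1 / \<tau>) = ennreal ((J * L powr s) powr (1 / \<tau>))"
          using J by (intro ennpowr_ennreal) simp
        then show ?thesis using C2 by (simp only: D_def ennreal_mult' ennreal_mult'' powr_ge_zero mult_ac
          less_imp_le mult_nonneg_nonneg)
      qed
      finally have "nn_avg ?Q (\<lambda>x. g x * W x) * emeasure lebesgue ?Q \<le> ennreal D * nn_avg ?Q W * emeasure lebesgue ?Q"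
        by (rule mult_right_mono) simp
      moreover have "nn_avg ?Q u * emeasure lebesgue ?Q = (\<integral>\<^sup>+x\<in>?Q. u x \<partial>lebesgue)" for u
      proof -
        have "ennreal (r ^ DIM('a)) / ennreal (r ^ DIM('a)) = 1"
          using r by (intro ennreal_divide_self) auto
        then show ?thesis
          unfolding nn_avg_def emeasure_cube[OF less_imp_le[OF r]] by (simp only: ennreal_divide_times mult_1_right)
      qed
      ultimately have le: "(\<integral>\<^sup>+x\<in>?Q. g x * W x \<partial>lebesgue) \<le> ennreal D * (\<integral>\<^sup>+x\<in>?Q. W x \<partial>lebesgue)"
        by (simp add: mult.assoc)
      have "(\<integral>\<^sup>+x\<in>?Q. g x * W x \<partial>lebesgue) / (\<integral>\<^sup>+x\<in>?Q. W x \<partial>lebesgue) \<le> ennreal D"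
      proof -
        consider "(\<integral>\<^sup>+x\<in>?Q. W x \<partial>lebesgue) = 0" | "(\<integral>\<^sup>+x\<in>?Q. W x \<partial>lebesgue) = top"
          | "(\<integral>\<^sup>+x\<in>?Q. W x \<partial>lebesgue) \<noteq> 0" "(\<integral>\<^sup>+x\<in>?Q. W x \<partial>lebesgue) \<noteq> top" by blast
        then show ?thesis
        proof cases
          case 1
          (* then the numerator vanishes too, and 0 / 0 = 0 *)
          with le show ?thesis by simp
        next
          case 3
          then show ?thesis
            using divide_right_mono_ennreal[OF le, of "\<integral>\<^sup>+x\<in>?Q. W x \<partial>lebesgue"] by (simp add: ennreal_mult_divide_eq)
        qed simp
      qed
      then have "weighted_osc q \<omega> f ?Q \<le> ennpowr (ennreal D) (1 / q)"
        unfolding weighted_osc_def using q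
        by (intro ennpowr_mono) (auto simp: g_def W_def ennreal_mult)
      also have "D powr (1 / q) = c * K"
      proof -
        have "D powr (1 / q) = J powr (1 / s) * L * C2 powr (1 / q) * X powr (\<eta> / q)"
          using J L C2 X q \<sigma>\<tau> by (simp add: D_def powr_mult powr_powr s_def mult_ac)
        also have "L = C1 powr \<theta> * X powr ((N0 + 1) * \<theta>) * K"
          using C1 by (simp add: L_def powr_mult powr_powr)
        finally show ?thesis
          using X by (simp add: c_def C_def powr_add)
      qed
      moreover have "0 \<le> D" using C2 by (simp add: D_def)
      ultimately show ?thesis by simp
    qed
    have "weighted_osc q \<omega> f ?Q \<le> ennreal (c * N)"
    proof (rule ennreal_le_epsilon)
      fix e :: real assume e: "0 < e"
      have "weighted_osc q \<omega> f ?Q \<le> ennreal (c * (N + e / c))"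
        using e c by (intro bound) simp
      also have "\<dots> = ennreal (c * N) + ennreal e"
        using c e N by (simp add: distrib_left flip: ennreal_plus)
      finally show "weighted_osc q \<omega> f ?Q \<le> ennreal (c * N) + ennreal e" .
    qed
    then show ?thesis
      using N c by (simp add: c_def X_def ennreal_mult)
  qed
  with C show ?thesis by blast
qed

section \<open>Positivity of the critical radius\<close>

lemma AE_esssup_lebesgue_on:
  assumes "E \<in> sets lebesgue"
  shows "AE x in lebesgue. x \<in> E \<longrightarrow> g x \<le> esssup (lebesgue_on E) g"
  using esssup_AE[of g "lebesgue_on E"] assms by (simp add: AE_restrict_space_iff)

text \<open>Jensen's inequality lowers the exponent; the value \<open>DIM('a) / 2\<close> is the scaling invariant one.\<close>
lemma reverse_holder_half_dimension:
  fixes V :: "'a::euclidean_space \<Rightarrow> real"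
  assumes V: "admissible_potential V"
  defines "\<sigma> \<equiv> real DIM('a) / 2"
  obtains C where "0 < C" "\<And>x r. 0 < r \<Longrightarrow>
    ennpowr (nn_avg (ball x r) (\<lambda>y. ennreal (V y powr \<sigma>))) (1 / \<sigma>)
      \<le> ennreal C * nn_avg (ball x r) (\<lambda>y. ennreal (V y))"
proof -
  have \<sigma>: "0 < \<sigma>" by (simp add: \<sigma>_def)
  have V0: "\<And>x. 0 \<le> V x" and [measurable]: "V \<in> borel_measurable lebesgue"
    using V by (auto simp: admissible_potential_def locally_integrable_measurable)
  obtain s where s: "ereal \<sigma> \<le> s" and rh: "reverse_holder s V"
    using V by (auto simp: admissible_potential_def \<sigma>_def)
  obtain C where C: "0 < C" and le: "\<And>x r. 0 < r \<Longrightarrow> (if s = \<infinity> then esssup (lebesgue_on (ball x r)) (\<lambda>y. ennreal (V y))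
      else ennpowr (nn_avg (ball x r) (\<lambda>y. ennreal (V y powr real_of_ereal s)))
             (1 / real_of_ereal s))
     \<le> ennreal C * nn_avg (ball x r) (\<lambda>y. ennreal (V y))"
    using rh unfolding reverse_holder_def by blast
  have "ennpowr (nn_avg (ball x r) (\<lambda>y. ennreal (V y powr \<sigma>))) (1 / \<sigma>)
      \<le> ennreal C * nn_avg (ball x r) (\<lambda>y. ennreal (V y))" if r: "0 < r" for x r
  proof (cases "s = \<infinity>")
    case True
    let ?E = "esssup (lebesgue_on (ball x r)) (\<lambda>y. ennreal (V y))"
    have "AE y in lebesgue. y \<in> ball x r \<longrightarrow> ennreal (V y powr \<sigma>) \<le> ennpowr ?E \<sigma>"
    proof (rule eventually_mono[OF AE_esssup_lebesgue_on[of "ball x r" "\<lambda>y. ennreal (V y)"]])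
      fix y assume "y \<in> ball x r \<longrightarrow> ennreal (V y) \<le> ?E"
      then show "y \<in> ball x r \<longrightarrow> ennreal (V y powr \<sigma>) \<le> ennpowr ?E \<sigma>"
        using ennpowr_mono[of \<sigma> "ennreal (V y)" ?E] \<sigma> V0[of y] by simp
    qed simp
    then have "nn_avg (ball x r) (\<lambda>y. ennreal (V y powr \<sigma>)) \<le> nn_avg (ball x r) (\<lambda>y. ennpowr ?E \<sigma>)"
      by (rule nn_avg_mono_AE)
    also have "\<dots> \<le> ennpowr ?E \<sigma>"
      by (intro nn_avg_const_le) simp
    finally have "ennpowr (nn_avg (ball x r) (\<lambda>y. ennreal (V y powr \<sigma>))) (1 / \<sigma>) \<le> ennpowr (ennpowr ?E \<sigma>) (1 / \<sigma>)"
      using \<sigma> by (intro ennpowr_mono) auto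
    also have "\<dots> = ?E"
      using \<sigma> by (simp add: ennpowr_ennpowr)
    finally show ?thesis using le[OF r, of x] True by (auto intro: order_trans)
  next
    case False
    then obtain t where t: "s = ereal t" "\<sigma> \<le> t" using s by (cases s) auto
    have eq: "ennreal (V y powr a) = ennpowr (ennreal (V y)) a" for y a
      using V0 by simp
    have "ennpowr (nn_avg (ball x r) (\<lambda>y. ennreal (V y powr \<sigma>))) (1 / \<sigma>)
        \<le> ennpowr (nn_avg (ball x r) (\<lambda>y. ennreal (V y powr t))) (1 / t)"
      unfolding eq using \<sigma> t by (intro power_mean_nn_avg) auto
    then show ?thesis using le[OF r, of x] t by (auto intro: order_trans)
  qed
  with C show ?thesis by (rule that)
qed

text \<open>With \<open>\<sigma> = DIM('a) / 2\<close> and \<open>i r\<close> the \<open>L\<^sup>\<sigma>\<close> norm of \<open>V\<close> on \<open>ball x r\<close>, Hoelder's inequality and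
  its reverse compare \<open>(LINT y:ball x r|lebesgue. V y) / r ^ (DIM('a) - 2)\<close> with \<open>i r\<close> from above and
  below. Since \<open>i r\<close> tends to \<open>0\<close> with \<open>r\<close>, some radius lies in the set whose supremum is the critical
  radius. If the set were unbounded, so that its supremum would have no meaning, \<open>i\<close> would be bounded
  and \<open>V\<close> would lie in \<open>L\<^sup>\<sigma>\<close>. But then for large \<open>r\<close> only a tail of \<open>V\<close>, of small \<open>L\<^sup>\<sigma>\<close> norm, contributes to
  the quotient; by the reverse inequality \<open>i\<close> would have to vanish, contrary to \<open>V\<close> not being zero.\<close>
theorem critical_radius_pos:
  fixes V :: "'a::euclidean_space \<Rightarrow> real"
  assumes V: "admissible_potential V" and dim: "3 \<le> DIM('a)"
  shows "0 < critical_radius V x"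
proof -
  define \<sigma> where "\<sigma> = real DIM('a) / 2"
  define m where "m = DIM('a) - 2"
  have \<sigma>: "1 < \<sigma>" and m: "1 \<le> m" using dim by (auto simp: \<sigma>_def m_def)
  have V0: "\<And>x. 0 \<le> V x" and Vm [measurable]: "V \<in> borel_measurable lebesgue"
    and Vli: "locally_integrable V" and Vnz: "\<not> (AE x in lebesgue. V x = 0)"
    using V by (auto simp: admissible_potential_def locally_integrable_measurable)
  obtain C where C: "0 < C" and rh: "\<And>x r. 0 < r \<Longrightarrow>
    ennpowr (nn_avg (ball x r) (\<lambda>y. ennreal (V y powr \<sigma>))) (1 / \<sigma>)
      \<le> ennreal C * nn_avg (ball x r) (\<lambda>y. ennreal (V y))"
    using reverse_holder_half_dimension[OF V] unfolding \<sigma>_def by blast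
  define \<mu> where "\<mu> = density lebesgue (\<lambda>y. ennreal (V y powr \<sigma>))"
  have sets_\<mu> [simp, measurable_cong]: "sets \<mu> = sets lebesgue" by (simp add: \<mu>_def)
  have em: "emeasure \<mu> E = (\<integral>\<^sup>+y\<in>E. ennreal (V y powr \<sigma>) \<partial>lebesgue)" if "E \<in> sets lebesgue" for E
    unfolding \<mu>_def using that by (intro emeasure_density) auto
  have [measurable]: "ball x r \<in> sets lebesgue" for r
    by simp
  define v where "v = (\<lambda>r. LINT y:ball x r|lebesgue. V y)"
  have int: "set_integrable lebesgue (ball x r) V" for r
  proof (rule set_integrable_subset)
    show "set_integrable lebesgue (cball x r) V"
      using Vli by (simp add: locally_integrable_def)
    show "ball x r \<subseteq> cball x r"
      by (rule ball_subset_cball)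
  qed simp
  have nn: "(\<integral>\<^sup>+y\<in>ball x r. ennreal (V y) \<partial>lebesgue) = ennreal (v r)" for r
  proof -
    have "(\<integral>\<^sup>+y\<in>ball x r. ennreal (V y) \<partial>lebesgue) = (\<integral>\<^sup>+y. ennreal (indicator (ball x r) y * V y) \<partial>lebesgue)"
      by (intro nn_integral_cong) (auto simp: indicator_def)
    also have "\<dots> = ennreal (v r)"
      unfolding v_def set_lebesgue_integral_def real_scaleR_def
    proof (rule nn_integral_eq_integral)
      show "integrable lebesgue (\<lambda>y. indicator (ball x r) y * V y)"
        using int[of r] by (simp only: set_integrable_def real_scaleR_def)
    qed (use V0 in simp)
    finally show ?thesis .
  qed
  have v0: "0 \<le> v r" for r
    unfolding v_def set_lebesgue_integral_def real_scaleR_def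
    by (intro integral_nonneg_AE AE_I2 mult_nonneg_nonneg V0) simp
  define \<beta> where "\<beta> = unit_ball_vol DIM('a)"
  have \<beta>: "0 < \<beta>" by (simp add: \<beta>_def)
  define b where "b = \<beta> powr (1 - 1 / \<sigma>)"
  have b: "0 < b" using \<beta> by (simp add: b_def)
  have vol: "(\<beta> * r ^ DIM('a)) powr (1 - 1 / \<sigma>) = b * r ^ m" if "0 < r" for r
  proof -
    have "(r ^ DIM('a)) powr (1 - 1 / \<sigma>) = r powr (DIM('a) * (1 - 1 / \<sigma>))"
      using that by (simp add: powr_powr flip: powr_realpow)
    also have "DIM('a) * (1 - 1 / \<sigma>) = real m"
      using dim by (simp add: \<sigma>_def m_def field_simps)
    finally show ?thesis using that \<beta> by (simp add: powr_mult b_def powr_realpow)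
  qed
  have hoelder: "(\<integral>\<^sup>+y\<in>E. ennreal (V y) \<partial>lebesgue) \<le> ennpowr (emeasure \<mu> E) (1 / \<sigma>) * ennreal (b * r ^ m)"
    if E [measurable]: "E \<in> sets lebesgue" and sub: "E \<subseteq> ball x r" and r: "0 < r" for E r
  proof -
    define \<tau> where "\<tau> = \<sigma> / (\<sigma> - 1)"
    have \<tau>: "1 < \<tau>" "1 / \<sigma> + 1 / \<tau> = 1" "1 / \<tau> = 1 - 1 / \<sigma>"
      using \<sigma> by (auto simp: \<tau>_def field_simps)
    have "(\<integral>\<^sup>+y\<in>E. ennreal (V y) \<partial>lebesgue) = (\<integral>\<^sup>+y. (ennreal (V y) * indicator E y) * indicator (ball x r) y \<partial>lebesgue)"
      using sub by (intro nn_integral_cong) (auto simp: indicator_def)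
    also have "\<dots> \<le> ennpowr (\<integral>\<^sup>+y. ennpowr (ennreal (V y) * indicator E y) \<sigma> \<partial>lebesgue) (1 / \<sigma>)
        * ennpowr (\<integral>\<^sup>+y. ennpowr (indicator (ball x r) y) \<tau> \<partial>lebesgue) (1 / \<tau>)"
      by (rule Hoelder_nn_integral[OF \<sigma> \<tau>(1,2)]) measurable
    also have "(\<integral>\<^sup>+y. ennpowr (ennreal (V y) * indicator E y) \<sigma> \<partial>lebesgue) = emeasure \<mu> E"
      unfolding em[OF E] using V0 by (intro nn_integral_cong) (auto simp: indicator_def)
    also have "(\<integral>\<^sup>+y. ennpowr (indicator (ball x r) y) \<tau> \<partial>lebesgue) = (\<integral>\<^sup>+y. indicator (ball x r) y \<partial>lebesgue)"
      by (intro nn_integral_cong) (auto simp: indicator_def)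
    also have "\<dots> = ennreal (\<beta> * r ^ DIM('a))"
      using r by (simp add: emeasure_ball \<beta>_def)
    also have "ennpowr \<dots> (1 / \<tau>) = ennreal (b * r ^ m)"
      using r \<beta> by (subst ennpowr_ennreal) (simp_all add: \<tau>(3) vol)
    finally show ?thesis .
  qed
  have rev: "ennpowr (emeasure \<mu> (ball x r)) (1 / \<sigma>) * ennreal (b * r ^ m) \<le> ennreal (C * v r)" if r: "0 < r" for r
  proof -
    let ?B = "ennreal (\<beta> * r ^ DIM('a))"
    have B: "?B \<noteq> 0" "?B \<noteq> top" using \<beta> r by simp_all
    have "ennpowr (emeasure \<mu> (ball x r)) (1 / \<sigma>) / ennpowr ?B (1 / \<sigma>) \<le> ennreal (C * v r) / ?B"
    proof -
      have "emeasure lebesgue (ball x r) = ?B"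
        using r by (simp add: emeasure_ball \<beta>_def)
      from rh[OF r, of x, unfolded nn_avg_def nn this] show ?thesis
        using \<sigma> C v0[of r] by (simp add: em ennpowr_divide ennreal_times_divide del: ennpowr_ennreal flip: ennreal_mult)
    qed
    then have "ennpowr (emeasure \<mu> (ball x r)) (1 / \<sigma>) / ennpowr ?B (1 / \<sigma>) * ?B \<le> ennreal (C * v r) / ?B * ?B"
      by (rule mult_right_mono) simp
    moreover have "ennreal (C * v r) / ?B * ?B = ennreal (C * v r)"
      using B by (simp add: ennreal_divide_times)
    moreover have "?B / ennpowr ?B (1 / \<sigma>) = ennreal (b * r ^ m)"
    proof -
      have "?B / ennpowr ?B (1 / \<sigma>) = ennreal (\<beta> * r ^ DIM('a) / (\<beta> * r ^ DIM('a)) powr (1 / \<sigma>))"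
        using \<beta> r by (subst ennpowr_ennreal) (simp_all add: divide_ennreal)
      also have "\<beta> * r ^ DIM('a) / (\<beta> * r ^ DIM('a)) powr (1 / \<sigma>) = (\<beta> * r ^ DIM('a)) powr (1 - 1 / \<sigma>)"
        using \<beta> r by (simp add: powr_diff)
      finally show ?thesis by (simp add: vol r)
    qed
    ultimately show ?thesis by (simp add: ennreal_divide_times)
  qed
  have fin: "emeasure \<mu> (ball x r) < top" if r: "0 < r" for r
  proof -
    have "ennpowr (emeasure \<mu> (ball x r)) (1 / \<sigma>) * ennreal (b * r ^ m) < top"
      using rev[OF r] by (rule le_less_trans) simp
    then have "ennpowr (emeasure \<mu> (ball x r)) (1 / \<sigma>) \<noteq> top"
      using b r by (auto simp: ennreal_top_mult)
    then show ?thesis by (simp add: less_top)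
  qed
  define i where "i = (\<lambda>r. measure \<mu> (ball x r) powr (1 / \<sigma>))"
  have emi: "ennpowr (emeasure \<mu> (ball x r)) (1 / \<sigma>) = ennreal (i r)" if "0 < r" for r
    using fin[OF that] unfolding i_def by (subst emeasure_eq_ennreal_measure) auto
  have up: "v r \<le> i r * (b * r ^ m)" if r: "0 < r" for r
    using hoelder[of "ball x r" r] r b unfolding nn emi[OF r]
    by (simp add: i_def ennreal_le_iff flip: ennreal_mult)
  have lo: "i r * (b * r ^ m) \<le> C * v r" if r: "0 < r" for r
    using rev[OF r] r b C v0[of r] unfolding emi[OF r]
    by (simp add: i_def ennreal_le_iff flip: ennreal_mult)
  have i_mono: "i r \<le> i R" if "0 < r" "r \<le> R" for r R
    unfolding i_def using \<sigma> fin[of R] that by (intro powr_mono2 measure_mono_fmeasurable) (auto simp: fmeasurable_def)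
  define S where "S = {r. 0 < r \<and> 1 / r ^ m * v r \<le> 1}"
  have S: "r \<in> S \<longleftrightarrow> 0 < r \<and> v r \<le> r ^ m" for r
    by (auto simp: S_def field_simps)
  have cr: "critical_radius V x = Sup S"
    by (simp add: critical_radius_def S_def m_def v_def)
  have "\<exists>r. r \<in> S"
  proof -
    have "(\<lambda>n. emeasure \<mu> (ball x (1 / Suc n))) \<longlonglongrightarrow> emeasure \<mu> (\<Inter>n. ball x (1 / Suc n))"
    proof (rule Lim_emeasure_decseq)
      show "decseq (\<lambda>n. ball x (1 / Suc n))"
        unfolding decseq_def by (intro allI impI subset_ball) (simp add: frac_le)
      show "emeasure \<mu> (ball x (1 / Suc n)) \<noteq> \<infinity>" for n
        using fin[of "1 / Suc n"] by simp
    qed auto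
    also have "(\<Inter>n. ball x (1 / Suc n)) = {x}"
    proof -
      have "y = x" if "\<And>n. dist x y < 1 / Suc n" for y
      proof (rule ccontr)
        assume "y \<noteq> x"
        then obtain n where "inverse (real (Suc n)) < dist x y"
          using reals_Archimedean[of "dist x y"] by auto
        with that[of n] show False by (simp add: inverse_eq_divide)
      qed
      then show ?thesis by auto
    qed
    also have "emeasure \<mu> {x} = 0"
    proof -
      have "{x} \<in> null_sets lebesgue"
        using negligible_sing negligible_iff_null_sets by blast
      then have "AE y in lebesgue. y \<notin> {x}" by (rule AE_not_in)
      then have "AE y in lebesgue. ennreal (V y powr \<sigma>) * indicator {x} y = 0"
        by (rule eventually_mono) auto
      then show ?thesis by (subst em) (auto simp: nn_integral_0_iff_AE)
    qed
    finally have "(\<lambda>n. emeasure \<mu> (ball x (1 / Suc n))) \<longlonglongrightarrow> 0" .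
    then have "\<forall>\<^sub>F n in sequentially. emeasure \<mu> (ball x (1 / Suc n)) < ennreal ((1 / b) powr \<sigma>)"
      using b by (intro order_tendstoD) auto
    then obtain n where n: "emeasure \<mu> (ball x (1 / Suc n)) < ennreal ((1 / b) powr \<sigma>)"
      by (auto simp: eventually_sequentially)
    define r where "r = 1 / real (Suc n)"
    have r: "0 < r" by (simp add: r_def)
    have "measure \<mu> (ball x r) \<le> (1 / b) powr \<sigma>"
      using n unfolding r_def measure_def by (intro enn2real_leI) (auto intro: less_imp_le)
    then have "i r \<le> ((1 / b) powr \<sigma>) powr (1 / \<sigma>)"
      unfolding i_def using \<sigma> by (intro powr_mono2) auto
    also have "\<dots> = 1 / b" using \<sigma> b by (simp add: powr_powr)
    finally have "i r * (b * r ^ m) \<le> 1 / b * (b * r ^ m)"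
      using b r by (intro mult_right_mono) auto
    then have "v r \<le> r ^ m" using up[OF r] b by simp
    then show ?thesis using r S by blast
  qed
  then obtain r0 where r0: "r0 \<in> S" ..
  have "bdd_above S"
  proof (rule ccontr)
    assume "\<not> bdd_above S"
    then have unb: "\<exists>r\<in>S. R < r" for R by (auto simp: bdd_above_def not_le)
    define K where "K = (C / b) powr \<sigma>"
    have bound: "emeasure \<mu> (ball x R) \<le> ennreal K" for R
    proof -
      obtain r where r: "r \<in> S" "R < r" using unb by blast
      then have r': "0 < r" "v r \<le> r ^ m" by (auto simp: S)
      have "i r * (b * r ^ m) \<le> C * r ^ m"
        using lo[OF r'(1)] r'(2) C by (meson order_trans mult_left_mono less_imp_le)
      then have "i r \<le> C / b" using r' b by (simp add: field_simps)
      then have "i r powr \<sigma> \<le> K" unfolding K_def using \<sigma> by (intro powr_mono2) (auto simp: i_def)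
      then have "measure \<mu> (ball x r) \<le> K" using \<sigma> by (simp add: i_def powr_powr)
      then have "emeasure \<mu> (ball x r) \<le> ennreal K"
        using fin[OF r'(1)] by (subst emeasure_eq_ennreal_measure) (auto intro: ennreal_leI)
      moreover have "emeasure \<mu> (ball x R) \<le> emeasure \<mu> (ball x r)"
        using r(2) by (intro emeasure_mono) auto
      ultimately show ?thesis by order
    qed
    have UN: "(\<Union>n. ball x (real n)) = UNIV"
      using reals_Archimedean2 by (auto simp: set_eq_iff)
    have "(\<lambda>n. emeasure \<mu> (ball x (real n))) \<longlonglongrightarrow> emeasure \<mu> (\<Union>n. ball x (real n))"
      by (intro Lim_emeasure_incseq) (auto simp: incseq_def)
    then have "emeasure \<mu> UNIV \<le> ennreal K"
      unfolding UN using bound by (intro LIMSEQ_le_const2) auto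
    then have fin_UNIV: "emeasure \<mu> UNIV < top" by (rule le_less_trans) simp
    (* R is chosen so that outside ball x R the L\<^sup>\<sigma> norm of V is at most \<delta>. *)
    have tail: "\<exists>R>0. \<forall>r\<ge>R. v r \<le> v R + \<delta> * (b * r ^ m)" if \<delta>: "0 < \<delta>" for \<delta>
    proof -
      have "(\<lambda>n. emeasure \<mu> (- ball x (real n))) \<longlonglongrightarrow> emeasure \<mu> (\<Inter>n. - ball x (real n))"
      proof (rule Lim_emeasure_decseq)
        show "emeasure \<mu> (- ball x (real n)) \<noteq> \<infinity>" for n
          using emeasure_mono[of "- ball x (real n)" UNIV \<mu>] fin_UNIV by (auto simp: less_top)
      qed (auto simp: decseq_def)
      also have "(\<Inter>n. - ball x (real n)) = {}" using UN by auto
      finally have "\<forall>\<^sub>F n in sequentially. emeasure \<mu> (- ball x (real n)) < ennreal (\<delta> powr \<sigma>)"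
        using \<delta> by (intro order_tendstoD) auto
      then obtain n where n: "emeasure \<mu> (- ball x (real (Suc n))) < ennreal (\<delta> powr \<sigma>)"
        by (auto simp: eventually_sequentially dest: spec[of _ "Suc _"] intro: le_SucI)
      define R where "R = real (Suc n)"
      have "v r \<le> v R + \<delta> * (b * r ^ m)" if rR: "R \<le> r" for r
      proof -
        have r: "0 < r" using rR by (simp add: R_def)
        let ?T = "ball x r - ball x R"
        have "emeasure \<mu> ?T \<le> ennreal (\<delta> powr \<sigma>)"
          using n unfolding R_def[symmetric]
          by (intro order_trans[OF emeasure_mono less_imp_le]) auto
        then have "ennpowr (emeasure \<mu> ?T) (1 / \<sigma>) \<le> ennreal \<delta>"
          using ennpowr_mono[of "1 / \<sigma>" _ "ennreal (\<delta> powr \<sigma>)"] \<sigma> \<delta> by (simp add: powr_powr)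
        then have T: "(\<integral>\<^sup>+y\<in>?T. ennreal (V y) \<partial>lebesgue) \<le> ennreal \<delta> * ennreal (b * r ^ m)"
          using r by (intro order_trans[OF hoelder[of ?T r] mult_right_mono]) auto
        have "ennreal (v r) = (\<integral>\<^sup>+y. ennreal (V y) * indicator (ball x R) y + ennreal (V y) * indicator ?T y \<partial>lebesgue)"
          unfolding nn[symmetric] using rR by (intro nn_integral_cong) (auto simp: indicator_def)
        also have "\<dots> = ennreal (v R) + (\<integral>\<^sup>+y\<in>?T. ennreal (V y) \<partial>lebesgue)"
          unfolding nn[symmetric] by (intro nn_integral_add) measurable
        also have "\<dots> \<le> ennreal (v R) + ennreal \<delta> * ennreal (b * r ^ m)"
          using T by (rule add_left_mono)
        also have "\<dots> = ennreal (v R + \<delta> * (b * r ^ m))"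
          using \<delta> b r v0 by (simp flip: ennreal_mult ennreal_plus)
        finally show ?thesis
          using \<delta> b r v0[of R] by (simp add: ennreal_le_iff del: ennreal_plus)
      qed
      then show ?thesis by (intro exI[of _ R]) (simp add: R_def)
    qed
    (* As r tends to infinity, v R becomes negligible against r ^ m, because m > 0. *)
    have i_le: "i R0 \<le> 0" if R0: "0 < R0" for R0
    proof (rule field_le_epsilon)
      fix e :: real assume e: "0 < e"
      define \<delta> where "\<delta> = e / (1 + C)"
      have "(1 + C) * \<delta> = e" using C by (simp add: \<delta>_def)
      then have "\<delta> + C * \<delta> = e" by (simp only: distrib_right mult_1_left)
      moreover have "0 < \<delta>" using e C by (simp add: \<delta>_def)
      ultimately have \<delta>: "0 < \<delta>" "\<delta> + C * \<delta> = e" by blast+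
      obtain R where R: "0 < R" and tl: "\<And>r. R \<le> r \<Longrightarrow> v r \<le> v R + \<delta> * (b * r ^ m)"
        using tail[OF \<delta>(1)] by blast
      define r where "r = max (max R R0) (max 1 (C * v R / (\<delta> * b)))"
      have r: "R \<le> r" "R0 \<le> r" "1 \<le> r" "C * v R / (\<delta> * b) \<le> r" by (auto simp: r_def)
      have "r \<le> r ^ m" using r(3) m by (simp add: self_le_power)
      then have "C * v R / (\<delta> * b) \<le> r ^ m" using r(4) by linarith
      then have CvR: "C * v R \<le> \<delta> * (b * r ^ m)" using \<delta> b by (simp add: field_simps)
      have "i r * (b * r ^ m) \<le> C * v r" using lo r by simp
      also have "\<dots> \<le> C * (v R + \<delta> * (b * r ^ m))" using tl[OF r(1)] C by simp
      also have "\<dots> \<le> \<delta> * (b * r ^ m) + C * (\<delta> * (b * r ^ m))" using CvR by (simp add: distrib_left)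
      also have "\<dots> = e * (b * r ^ m)" using \<delta>(2) by (simp flip: distrib_right mult.assoc)
      finally have "i r \<le> e" using b r by simp
      then show "i R0 \<le> 0 + e" using i_mono[OF R0 r(2)] by simp
    qed
    have "AE y in lebesgue. \<forall>n. y \<in> ball x (real (Suc n)) \<longrightarrow> V y = 0"
      unfolding AE_all_countable
    proof
      fix n
      have "i (real (Suc n)) = 0" using i_le[of "real (Suc n)"] by (simp add: i_def)
      then have "measure \<mu> (ball x (real (Suc n))) = 0" by (simp add: i_def)
      then have "emeasure \<mu> (ball x (real (Suc n))) = 0"
        using fin[of "real (Suc n)"] by (subst emeasure_eq_ennreal_measure) auto
      then have "AE y in lebesgue. ennreal (V y powr \<sigma>) * indicator (ball x (real (Suc n))) y = 0"
        by (subst (asm) em) (auto simp: nn_integral_0_iff_AE)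
      then show "AE y in lebesgue. y \<in> ball x (real (Suc n)) \<longrightarrow> V y = 0"
        by (rule eventually_mono) (auto simp: indicator_def)
    qed
    then have "AE y in lebesgue. V y = 0"
    proof (rule eventually_mono)
      fix y assume y: "\<forall>n. y \<in> ball x (real (Suc n)) \<longrightarrow> V y = 0"
      obtain n where "dist x y < real n" using reals_Archimedean2 by blast
      then show "V y = 0" using y[rule_format, of n] by auto
    qed
    with Vnz show False by blast
  qed
  then have "r0 \<le> Sup S" using r0 by (intro cSup_upper)
  then show ?thesis using r0 by (simp add: cr S)
qed

section \<open>The Muckenhoupt condition and the converse\<close>

lemma ess_inf_AE:
  assumes "E \<in> sets lebesgue"
  shows "AE x in lebesgue. x \<in> E \<longrightarrow> ess_inf E g \<le> g x"
proof (cases "ess_inf E g = 0")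
  case False
  then have "0 < ess_inf E g" by (simp add: zero_less_iff_neq_zero)
  then obtain u :: "nat \<Rightarrow> ennreal" where u: "\<And>n. u n < ess_inf E g" "u \<longlonglongrightarrow> ess_inf E g"
    using approx_from_below_dense_linorder by blast
  have "AE x in lebesgue_on E. \<forall>n. u n < g x"
    unfolding AE_all_countable using u(1) less_LiminfD unfolding ess_inf_def by blast
  then have "AE x in lebesgue_on E. ess_inf E g \<le> g x"
  proof (rule eventually_mono)
    fix x assume "\<forall>n. u n < g x"
    then show "ess_inf E g \<le> g x"
      by (intro LIMSEQ_le_const2[OF u(2)]) (auto intro: less_imp_le)
  qed
  then show ?thesis using assms by (simp add: AE_restrict_space_iff)
qed simp

lemma inverse_ennreal_antimono: "x \<le> y \<Longrightarrow> inverse y \<le> inverse (x :: ennreal)"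
proof (cases x; cases y)
  fix a b assume "x \<le> y" "x = ennreal a" "0 \<le> a" "y = ennreal b" "0 \<le> b"
  then show ?thesis
    by (cases "a = 0") (auto simp: inverse_ennreal intro!: ennreal_leI)
qed (auto simp: top_unique)

text \<open>Lowering the exponent \<open>p / (p - 1)\<close> of the negative power, which for \<open>p = 1\<close> is infinite, to
  \<open>q / (q - 1)\<close> lowers the constant; this makes both factors conjugate powers of \<open>\<omega>\<close>.\<close>
lemma A_const_diagonal_le:
  fixes \<omega> :: "'a::euclidean_space \<Rightarrow> real"
  assumes w [measurable]: "\<omega> \<in> borel_measurable lebesgue" and w0: "\<And>x. 0 \<le> \<omega> x" and pq: "1 \<le> p" "p < q"
  shows "A_const \<rho> \<theta> q q \<omega> \<le> A_const \<rho> \<theta> p q \<omega>"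
proof -
  define q' where "q' = q / (q - 1)"
  have q': "0 < q'" using pq by (simp add: q'_def)
  have eq: "inverse (ennreal (\<omega> x powr a)) = ennpowr (inverse (ennreal (\<omega> x))) a" if "0 < a" for x a
    using that w0 by (simp add: ennpowr_inverse)
  have "ennpowr (nn_avg B (\<lambda>x. inverse (ennreal (\<omega> x powr q')))) (1 / q')
    \<le> (if p = 1 then inverse (ess_inf B (\<lambda>x. ennreal (\<omega> x)))
      else let p' = p / (p - 1) in
        ennpowr (nn_avg B (\<lambda>x. inverse (ennreal (\<omega> x powr p')))) (1 / p'))" (is "?l \<le> ?r")
    if B [measurable]: "B \<in> sets lebesgue" for B
  proof (cases "p = 1")
    case True
    let ?m = "ess_inf B (\<lambda>x. ennreal (\<omega> x))"
    have "AE x in lebesgue. x \<in> B \<longrightarrow> inverse (ennreal (\<omega> x powr q')) \<le> ennpowr (inverse ?m) q'"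
      using ess_inf_AE[OF B, of "\<lambda>x. ennreal (\<omega> x)"]
      by (rule eventually_mono) (use q' in \<open>auto simp: eq intro!: ennpowr_mono inverse_ennreal_antimono\<close>)
    then have "nn_avg B (\<lambda>x. inverse (ennreal (\<omega> x powr q'))) \<le> nn_avg B (\<lambda>x. ennpowr (inverse ?m) q')"
      by (rule nn_avg_mono_AE)
    also have "\<dots> \<le> ennpowr (inverse ?m) q'" by (rule nn_avg_const_le[OF B])
    finally have "?l \<le> ennpowr (ennpowr (inverse ?m) q') (1 / q')"
      using q' by (intro ennpowr_mono) auto
    then show ?thesis using q' True by (simp add: ennpowr_ennpowr)
  next
    case False
    define p' where "p' = p / (p - 1)"
    have p': "q' \<le> p'" using pq False by (simp add: p'_def q'_def field_simps)
    have "?l \<le> ennpowr (nn_avg B (\<lambda>x. inverse (ennreal (\<omega> x powr p')))) (1 / p')"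
      using power_mean_nn_avg[OF q' p', of "\<lambda>x. inverse (ennreal (\<omega> x))" B] q' p' by (simp add: eq)
    then show ?thesis using False by (simp add: p'_def Let_def)
  qed
  then have *: "ennpowr (nn_avg (ball x r) (\<lambda>x. inverse (ennreal (\<omega> x powr q')))) (1 / q')
    \<le> (if p = 1 then inverse (ess_inf (ball x r) (\<lambda>x. ennreal (\<omega> x)))
      else let p' = p / (p - 1) in
        ennpowr (nn_avg (ball x r) (\<lambda>x. inverse (ennreal (\<omega> x powr p')))) (1 / p'))" for x r
    by simp
  have q1: "q \<noteq> 1" using pq by simp
  show ?thesis
    unfolding A_const_def if_not_P[OF q1] Let_def q'_def[symmetric]
    by (intro SUP_mono' mult_left_mono *[unfolded Let_def]) simp
qed

lemma A_const_ball_le: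
  fixes \<rho> \<omega> :: "'a::euclidean_space \<Rightarrow> real"
  assumes "0 < \<rho> x" "0 < r" "1 < q"
  defines "q' \<equiv> q / (q - 1)"
  shows "ennpowr (nn_avg (ball x r) (\<lambda>x. ennreal (\<omega> x powr q))) (1 / q) *
      ennpowr (nn_avg (ball x r) (\<lambda>x. inverse (ennreal (\<omega> x powr q')))) (1 / q')
    \<le> ennreal ((1 + r / \<rho> x) powr \<theta>) * A_const \<rho> \<theta> q q \<omega>" (is "?F * ?G \<le> _")
proof -
  let ?a = "1 + r / \<rho> x"
  have a: "0 < ?a" using assms by (simp add: add_pos_pos)
  have q1: "q \<noteq> 1" using assms by simp
  have "ennreal (?a powr (- \<theta>)) * ?F * ?G \<le> A_const \<rho> \<theta> q q \<omega>"
    unfolding A_const_def if_not_P[OF q1] Let_def q'_def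
    by (rule SUP_upper2[OF UNIV_I], rule SUP_upper2[of r]) (use assms in auto)
  then have "ennreal (?a powr \<theta>) * (ennreal (?a powr (- \<theta>)) * ?F * ?G) \<le> ennreal (?a powr \<theta>) * A_const \<rho> \<theta> q q \<omega>"
    by (rule mult_left_mono) simp
  moreover have "ennreal (?a powr \<theta>) * ennreal (?a powr (- \<theta>)) = 1"
    using a by (simp flip: ennreal_mult powr_add)
  ultimately show ?thesis by (simp flip: mult.assoc)
qed

lemma unit_ball_vol_neq_0: "unit_ball_vol (real n) \<noteq> 0"
  by (metis less_irrefl of_nat_0_le_iff unit_ball_vol_pos)

lemma nn_avg_eq_0D:
  assumes "nn_avg E g = 0" "emeasure lebesgue E \<noteq> top" "g \<in> borel_measurable lebesgue" "E \<in> sets lebesgue"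
  shows "AE x in lebesgue. x \<in> E \<longrightarrow> g x = 0"
proof -
  have "(\<integral>\<^sup>+x\<in>E. g x \<partial>lebesgue) = 0"
    using assms(1,2) by (simp add: nn_avg_def)
  then have "AE x in lebesgue. g x * indicator E x = 0"
    using assms(3,4) by (subst (asm) nn_integral_0_iff_AE) auto
  then show ?thesis by (rule eventually_mono) (auto simp: indicator_def)
qed

lemma nn_avg_neq_topD:
  assumes "nn_avg E g \<noteq> top" "emeasure lebesgue E \<noteq> top" "g \<in> borel_measurable lebesgue" "E \<in> sets lebesgue"
  shows "AE x in lebesgue. x \<in> E \<longrightarrow> g x \<noteq> top"
proof -
  have "(\<integral>\<^sup>+x\<in>E. g x \<partial>lebesgue) \<noteq> top"
    using assms(1,2) by (auto simp: nn_avg_def ennreal_top_divide)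
  then have "AE x in lebesgue. g x * indicator E x \<noteq> \<infinity>"
    using assms(3,4) by (intro nn_integral_PInf_AE) auto
  then show ?thesis by (rule eventually_mono) (auto simp: indicator_def)
qed

text \<open>A product of \<open>0\<close> and \<open>\<infinity>\<close> is \<open>0\<close>, so the finiteness of the constant does not at once give that of
  its two factors. But if one of them vanished on a ball, it would be the average of \<open>\<omega> powr q\<close>; then the
  other factor would be infinite on all larger concentric balls, \<open>\<omega>\<close> would vanish on them as well, and so
  almost everywhere.\<close>
lemma A_const_factors:
  fixes \<rho> \<omega> :: "'a::euclidean_space \<Rightarrow> real"
  assumes \<rho>: "0 < \<rho> x" and r: "0 < r" and q: "1 < q" and w: "weight \<omega>"
    and fin: "A_const \<rho> \<theta> q q \<omega> < \<infinity>"
  defines "q' \<equiv> q / (q - 1)"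
  shows "nn_avg (ball x r) (\<lambda>x. ennreal (\<omega> x powr q)) \<noteq> top"
    and "AE y in lebesgue. y \<in> ball x r \<longrightarrow> \<omega> y \<noteq> 0"
proof -
  have w0: "\<And>x. 0 \<le> \<omega> x" and [measurable]: "\<omega> \<in> borel_measurable lebesgue"
    using w by (auto simp: weight_def locally_integrable_measurable)
  have q': "0 < q'" using q by (simp add: q'_def)
  define F where "F = (\<lambda>r. nn_avg (ball x r) (\<lambda>x. ennreal (\<omega> x powr q)))"
  define G where "G = (\<lambda>r. nn_avg (ball x r) (\<lambda>x. inverse (ennreal (\<omega> x powr q'))))"
  have fin_ball: "emeasure lebesgue (ball x R) \<noteq> top" for R
    using emeasure_bounded_finite[of "ball x R"] by (simp add: less_top)
  have pos_ball: "emeasure lebesgue (ball x R) \<noteq> 0" if "0 < R" for R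
    using that by (simp add: emeasure_ball unit_ball_vol_neq_0)
  have not_AE_ball: "\<not> (AE y in lebesgue. y \<notin> ball x R)" if R: "0 < R" for R
    using pos_ball[OF R] AE_iff_null_sets[of "ball x R" lebesgue] null_setsD1[of "ball x R" lebesgue]
    by auto
  have FG: "ennpowr (F R) (1 / q) * ennpowr (G R) (1 / q') \<noteq> top" if R: "0 < R" for R
  proof -
    have "ennpowr (F R) (1 / q) * ennpowr (G R) (1 / q') < top"
      unfolding F_def G_def q'_def
      by (rule le_less_trans[OF A_const_ball_le[where \<rho> = \<rho> and \<theta> = \<theta>, OF \<rho> R q]])
         (use fin in \<open>auto simp: ennreal_mult_less_top\<close>)
    then show ?thesis by simp
  qed
  have G0: "G R \<noteq> 0" if R: "0 < R" for R
  proof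
    assume "G R = 0"
    then have "AE y in lebesgue. y \<in> ball x R \<longrightarrow> inverse (ennreal (\<omega> y powr q')) = 0"
      unfolding G_def using fin_ball by (intro nn_avg_eq_0D) auto
    then have "AE y in lebesgue. y \<notin> ball x R"
      by (rule eventually_mono) auto
    then show False
      using not_AE_ball[OF R] by contradiction
  qed
  have F0: "F R \<noteq> 0" if R: "0 < R" for R
  proof
    assume "F R = 0"
    then have "AE y in lebesgue. y \<in> ball x R \<longrightarrow> ennreal (\<omega> y powr q) = 0"
      unfolding F_def using fin_ball by (intro nn_avg_eq_0D) auto
    then have zero: "AE y in lebesgue. y \<in> ball x R \<longrightarrow> \<omega> y = 0"
      by (rule eventually_mono) (auto simp: ennreal_eq_0_iff)
    have "AE y in lebesgue. y \<in> ball x R' \<longrightarrow> \<omega> y = 0" if R': "R \<le> R'" for R'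
    proof -
      have pos': "0 < R'" using R R' by simp
      have "G R' = top"
      proof (rule ccontr)
        assume "G R' \<noteq> top"
        then have "AE y in lebesgue. y \<in> ball x R' \<longrightarrow> inverse (ennreal (\<omega> y powr q')) \<noteq> top"
          unfolding G_def using fin_ball by (intro nn_avg_neq_topD) auto
        with zero have "AE y in lebesgue. y \<notin> ball x R"
          by eventually_elim (use R' in auto)
        then show False
          using not_AE_ball[OF R] by contradiction
      qed
      then have "F R' = 0"
        using FG[OF pos'] by (auto simp: ennreal_mult_top split: if_splits)
      then have "AE y in lebesgue. y \<in> ball x R' \<longrightarrow> ennreal (\<omega> y powr q) = 0"
        unfolding F_def using fin_ball by (intro nn_avg_eq_0D) auto
      then show ?thesis by (rule eventually_mono) (auto simp: ennreal_eq_0_iff)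
    qed
    then have "AE y in lebesgue. \<forall>n. y \<in> ball x (R + real n) \<longrightarrow> \<omega> y = 0"
      unfolding AE_all_countable by simp
    then have "AE y in lebesgue. \<omega> y = 0"
    proof (rule eventually_mono)
      fix y assume y: "\<forall>n. y \<in> ball x (R + real n) \<longrightarrow> \<omega> y = 0"
      obtain n where "dist x y < real n" using reals_Archimedean2 by blast
      then show "\<omega> y = 0" using y[rule_format, of n] R by auto
    qed
    then show False using w by (simp add: weight_def)
  qed
  show "nn_avg (ball x r) (\<lambda>x. ennreal (\<omega> x powr q)) \<noteq> top"
    using FG[OF r] G0[OF r] by (auto simp: F_def ennreal_top_mult split: if_splits)
  have "G r \<noteq> top"
    using FG[OF r] F0[OF r] by (auto simp: ennreal_mult_top split: if_splits)
  then have "AE y in lebesgue. y \<in> ball x r \<longrightarrow> inverse (ennreal (\<omega> y powr q')) \<noteq> top"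
    unfolding G_def using fin_ball by (intro nn_avg_neq_topD) auto
  then show "AE y in lebesgue. y \<in> ball x r \<longrightarrow> \<omega> y \<noteq> 0"
    by (rule eventually_mono) auto
qed

lemma cube_subset_ball:
  assumes "0 < r"
  shows "cube x r \<subseteq> ball (x :: 'a::euclidean_space) (real DIM('a) * r)"
proof
  fix y assume "y \<in> cube x r"
  then have "dist y x \<le> real DIM('a) * r / 2" using dist_cube by blast
  also have "\<dots> < real DIM('a) * r" using assms by simp
  finally show "y \<in> ball x (real DIM('a) * r)" by (simp add: dist_commute)
qed

text \<open>The ball in turn lies in the cube of side \<open>2 * DIM('a) * r\<close>, which gives the ratio of the volumes.\<close>
lemma nn_avg_cube_le_ball:
  fixes x :: "'a::euclidean_space"
  assumes r: "0 < r"
  shows "nn_avg (cube x r) g \<le> ennreal ((2 * DIM('a)) ^ DIM('a)) * nn_avg (ball x (real DIM('a) * r)) g"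
proof -
  let ?B = "ball x (real DIM('a) * r)" and ?k = "real (2 * DIM('a)) ^ DIM('a)"
  have "?B \<subseteq> cube x (2 * real DIM('a) * r)"
  proof
    fix y assume "y \<in> ball x (real DIM('a) * r)"
    then have "norm (y - x) < real DIM('a) * r" by (simp add: dist_norm norm_minus_commute)
    then have "\<bar>(y - x) \<bullet> b\<bar> \<le> real DIM('a) * r" if "b \<in> Basis" for b
      using Basis_le_norm[OF that, of "y - x"] by linarith
    then show "y \<in> cube x (2 * real DIM('a) * r)" by (simp add: mem_cube)
  qed
  then have "emeasure lebesgue ?B \<le> emeasure lebesgue (cube x (2 * real DIM('a) * r))"
    by (intro emeasure_mono) auto
  also have "\<dots> = ennreal ((2 * real DIM('a) * r) ^ DIM('a))"
    using r by (intro emeasure_cube) simp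
  also have "(2 * real DIM('a) * r) ^ DIM('a) = ?k * r ^ DIM('a)"
    by (simp only: power_mult_distrib of_nat_mult of_nat_numeral)
  also have "ennreal \<dots> = ennreal ?k * ennreal (r ^ DIM('a))"
    using r by (intro ennreal_mult) simp_all
  finally have B: "emeasure lebesgue ?B \<le> ennreal ?k * ennreal (r ^ DIM('a))" .
  have B0: "emeasure lebesgue ?B \<noteq> 0" "emeasure lebesgue ?B \<noteq> top"
    using r emeasure_bounded_finite[of ?B] by (simp_all add: emeasure_ball unit_ball_vol_neq_0)
  let ?I = "\<integral>\<^sup>+y\<in>?B. g y \<partial>lebesgue"
  have "?I = nn_avg ?B g * emeasure lebesgue ?B"
    using B0 unfolding nn_avg_def by (simp add: ennreal_divide_times ennreal_divide_self less_top del: emeasure_completion)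
  also have "\<dots> \<le> nn_avg ?B g * (ennreal ?k * ennreal (r ^ DIM('a)))"
    by (intro mult_left_mono B) simp
  finally have I: "?I \<le> ennreal ?k * nn_avg ?B g * ennreal (r ^ DIM('a))"
    by (simp only: mult_ac)
  have "nn_avg (cube x r) g \<le> ?I / ennreal (r ^ DIM('a))"
    unfolding nn_avg_def emeasure_cube[OF less_imp_le[OF r]]
    using cube_subset_ball[OF r, of x]
    by (intro divide_right_mono_ennreal nn_integral_mono) (auto simp: indicator_def)
  also have "\<dots> \<le> ennreal ?k * nn_avg ?B g * ennreal (r ^ DIM('a)) / ennreal (r ^ DIM('a))"
    by (rule divide_right_mono_ennreal[OF I])
  also have "\<dots> = ennreal ?k * nn_avg ?B g"
    using r by (intro ennreal_mult_divide_eq) simp_all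
  finally show ?thesis by simp
qed

text \<open>Hoelder's inequality with the factors \<open>\<bar>f - avg Q f\<bar> * \<omega>\<close> and \<open>1 / \<omega>\<close> brings in the product of
  averages that the Muckenhoupt condition controls.\<close>
theorem bmo_norm_le_A_const:
  fixes \<rho> \<omega> f :: "'a::euclidean_space \<Rightarrow> real" and C :: real
  assumes \<rho>: "\<And>x. 0 < \<rho> x" and q: "1 < q" and \<theta>2: "0 < \<theta>2" and C: "0 < C" and w: "weight \<omega>"
    and fin: "A_const \<rho> \<theta>2 q q \<omega> < \<infinity>" and f: "locally_integrable f"
    and osc: "\<And>x0 r. 0 < r \<Longrightarrow> weighted_osc q \<omega> f (cube x0 r)
      \<le> ennreal (C * (1 + r / \<rho> x0) powr (\<theta>1 - \<theta>2))"
  shows "bmo_norm \<rho> \<theta>1 f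
    \<le> ennreal (C * (2 * real DIM('a)) ^ DIM('a) * real DIM('a) powr \<theta>2) * A_const \<rho> \<theta>2 q q \<omega>"
  unfolding bmo_norm_def
proof (intro SUP_least)
  fix x0 :: 'a and r :: real assume "r \<in> {0<..}"
  then have r: "0 < r" by simp
  define d where "d = real DIM('a)"
  define k where "k = (2 * d) ^ DIM('a)"
  define X where "X = 1 + r / \<rho> x0"
  define A where "A = A_const \<rho> \<theta>2 q q \<omega>"
  define q' where "q' = q / (q - 1)"
  have q': "1 < q'" "1 / q + 1 / q' = 1" using q by (auto simp: q'_def field_simps)
  have d: "1 \<le> d" using DIM_positive[where 'a = 'a] unfolding d_def by linarith
  have k: "0 < k" using d by (simp add: k_def)
  have X: "1 \<le> X" using r \<rho>[of x0] by (simp add: X_def)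
  have w0: "\<And>x. 0 \<le> \<omega> x" and [measurable]: "\<omega> \<in> borel_measurable lebesgue"
    using w by (auto simp: weight_def locally_integrable_measurable)
  have [measurable]: "f \<in> borel_measurable lebesgue" using f by (rule locally_integrable_measurable)
  let ?Q = "cube x0 r" and ?B = "ball x0 (d * r)"
  have dr: "0 < d * r" using d r by simp
  have sub: "?Q \<subseteq> ?B" unfolding d_def by (rule cube_subset_ball[OF r])
  define g where "g = (\<lambda>x. ennreal \<bar>f x - avg ?Q f\<bar>)"
  define W where "W = (\<lambda>x. ennreal (\<omega> x powr q))"
  define U where "U = (\<lambda>x. inverse (ennreal (\<omega> x powr q')))"
  have [measurable]: "g \<in> borel_measurable lebesgue" "W \<in> borel_measurable lebesgue"
    by (simp_all add: g_def W_def)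
  have U_eq: "U x = ennpowr (inverse (ennreal (\<omega> x))) q'" for x
    using w0[of x] q' by (simp add: U_def ennpowr_inverse)
  have Wfin: "nn_avg ?B W \<noteq> top" and nz: "AE y in lebesgue. y \<in> ?B \<longrightarrow> \<omega> y \<noteq> 0"
    using A_const_factors[where \<rho> = \<rho> and \<theta> = \<theta>2, OF \<rho> dr q w fin] by (simp_all add: W_def)
  define WQ where "WQ = (\<integral>\<^sup>+x\<in>?Q. W x \<partial>lebesgue)"
  have Q: "emeasure lebesgue ?Q \<noteq> 0" "emeasure lebesgue ?Q \<noteq> top"
    unfolding emeasure_cube[OF less_imp_le[OF r]] using r by simp_all
  have cube_ball: "nn_avg ?Q u \<le> ennreal k * nn_avg ?B u" for u
    using nn_avg_cube_le_ball[OF r, of x0 u] by (simp add: k_def d_def)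
  have "nn_avg ?Q W \<noteq> top"
    using cube_ball[of W] Wfin by (auto simp: top_unique ennreal_mult_eq_top_iff)
  then have WQ_top: "WQ \<noteq> top"
    using Q unfolding WQ_def nn_avg_def by (auto simp: ennreal_top_divide)
  have WQ_0: "WQ \<noteq> 0"
  proof
    assume "WQ = 0"
    then have "AE x in lebesgue. W x * indicator ?Q x = 0"
      unfolding WQ_def by (subst (asm) nn_integral_0_iff_AE) auto
    with nz have "AE x in lebesgue. x \<notin> ?Q"
      by eventually_elim (use sub w0 in \<open>auto simp: W_def ennreal_eq_0_iff indicator_def split: if_splits\<close>)
    then have "?Q \<in> null_sets lebesgue" by (simp add: AE_iff_null)
    with Q show False by (auto dest: null_setsD1)
  qed
  define I where "I = (\<integral>\<^sup>+x\<in>?Q. ennreal (\<bar>f x - avg ?Q f\<bar> powr q * \<omega> x powr q) \<partial>lebesgue)"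
  have osc': "ennpowr (I / WQ) (1 / q) \<le> ennreal (C * X powr (\<theta>1 - \<theta>2))"
    using osc[OF r, of x0] by (simp add: weighted_osc_def I_def WQ_def W_def X_def)
  have I: "nn_avg ?Q (\<lambda>x. ennpowr (g x * ennreal (\<omega> x)) q) = I / WQ * nn_avg ?Q W"
  proof -
    have "nn_avg ?Q (\<lambda>x. ennpowr (g x * ennreal (\<omega> x)) q) = I / emeasure lebesgue ?Q"
      unfolding nn_avg_def I_def g_def using q w0
      by (intro arg_cong2[where f = "(/)"] nn_integral_cong refl) (simp add: ennpowr_mult ennreal_mult)
    also have "I = I / WQ * WQ"
      using WQ_0 WQ_top by (simp add: ennreal_divide_times less_top)
    finally show ?thesis
      by (simp only: nn_avg_def WQ_def[symmetric] ennreal_times_divide)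
  qed
  have "nn_avg ?Q g \<le> nn_avg ?Q (\<lambda>x. (g x * ennreal (\<omega> x)) * inverse (ennreal (\<omega> x)))"
  proof (rule nn_avg_mono_AE, rule eventually_mono[OF nz], intro impI)
    fix x assume "x \<in> ?B \<longrightarrow> \<omega> x \<noteq> 0" "x \<in> ?Q"
    then have "0 < \<omega> x" using sub w0[of x] by (auto simp: less_le)
    then have "ennreal (\<omega> x) * inverse (ennreal (\<omega> x)) = 1"
      by (simp add: inverse_ennreal flip: ennreal_mult)
    then show "g x \<le> (g x * ennreal (\<omega> x)) * inverse (ennreal (\<omega> x))"
      by (simp add: mult.assoc)
  qed
  also have "\<dots> \<le> ennpowr (I / WQ * nn_avg ?Q W) (1 / q) * ennpowr (nn_avg ?Q U) (1 / q')"
    unfolding I[symmetric] U_eq by (rule Hoelder_nn_avg[OF q q']) measurable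
  also have "\<dots> \<le> ennreal (C * X powr (\<theta>1 - \<theta>2)) * ennpowr (ennreal k * nn_avg ?B W) (1 / q)
      * ennpowr (ennreal k * nn_avg ?B U) (1 / q')"
    using q q' osc' by (subst ennpowr_mult) (auto intro!: mult_mono ennpowr_mono cube_ball)
  also have "\<dots> = ennreal (C * X powr (\<theta>1 - \<theta>2)) * (ennpowr (ennreal k) (1 / q) * ennpowr (ennreal k) (1 / q'))
      * (ennpowr (nn_avg ?B W) (1 / q) * ennpowr (nn_avg ?B U) (1 / q'))"
    using q q' by (simp add: ennpowr_mult mult_ac del: ennpowr_ennreal)
  also have "ennpowr (ennreal k) (1 / q) * ennpowr (ennreal k) (1 / q') = ennreal k"
    using q q' by (subst ennpowr_add) simp_all
  also have "ennpowr (nn_avg ?B W) (1 / q) * ennpowr (nn_avg ?B U) (1 / q')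
      \<le> ennreal (d powr \<theta>2 * X powr \<theta>2) * A"
  proof -
    have "ennpowr (nn_avg ?B W) (1 / q) * ennpowr (nn_avg ?B U) (1 / q')
        \<le> ennreal ((1 + d * r / \<rho> x0) powr \<theta>2) * A"
      unfolding W_def U_def A_def q'_def by (rule A_const_ball_le[where \<rho> = \<rho>, OF \<rho> dr q])
    also have "(1 + d * r / \<rho> x0) powr \<theta>2 \<le> (d * X) powr \<theta>2"
      using \<theta>2 d dr \<rho>[of x0] by (intro powr_mono2) (auto simp: X_def distrib_left)
    also have "\<dots> = d powr \<theta>2 * X powr \<theta>2"
      using d X by (simp add: powr_mult)
    finally show ?thesis by (simp add: ennreal_leI mult_right_mono)
  qed
  finally have main: "nn_avg ?Q g \<le> ennreal (C * X powr (\<theta>1 - \<theta>2)) * ennreal k * (ennreal (d powr \<theta>2 * X powr \<theta>2) * A)"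
    by (simp add: mult_left_mono)
  have "ennreal (X powr (- \<theta>1)) * nn_avg ?Q g
      \<le> ennreal (X powr (- \<theta>1)) * (ennreal (C * X powr (\<theta>1 - \<theta>2)) * ennreal k * (ennreal (d powr \<theta>2 * X powr \<theta>2) * A))"
    by (intro mult_left_mono main) simp
  also have "\<dots> = ennreal (X powr (- \<theta>1) * (C * X powr (\<theta>1 - \<theta>2)) * k * (d powr \<theta>2 * X powr \<theta>2)) * A"
    using C k by (simp add: ennreal_mult mult.assoc)
  also have "X powr (- \<theta>1) * (C * X powr (\<theta>1 - \<theta>2)) * k * (d powr \<theta>2 * X powr \<theta>2)
      = C * k * d powr \<theta>2 * (X powr (- \<theta>1) * X powr (\<theta>1 - \<theta>2) * X powr \<theta>2)"
    by (simp add: mult_ac)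
  also have "X powr (- \<theta>1) * X powr (\<theta>1 - \<theta>2) * X powr \<theta>2 = 1"
    using X by (simp flip: powr_add)
  finally show "ennreal ((1 + r / \<rho> x0) powr (- \<theta>1)) * nn_avg ?Q (\<lambda>x. ennreal \<bar>f x - avg ?Q f\<bar>)
      \<le> ennreal (C * (2 * real DIM('a)) ^ DIM('a) * real DIM('a) powr \<theta>2) * A_const \<rho> \<theta>2 q q \<omega>"
    by (simp add: X_def g_def A_def k_def d_def)
qed

section \<open>Weighted characterisation of the space\<close>

theorem theorem3p2:
  fixes p q \<theta>2 :: real
  assumes "3 \<le> CARD('n::finite)"
    and "1 \<le> p" and "p < q" and "0 < \<theta>2"
  shows
    "(\<forall>(V :: real ^ 'n \<Rightarrow> real) \<omega> N0 \<eta> \<theta>1.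
        admissible_potential V \<longrightarrow>
        \<omega> \<in> A_class (critical_radius V) \<theta>2 p q \<longrightarrow>
        shen_exponent (critical_radius V) N0 \<longrightarrow>
        rh_exponent (critical_radius V) (\<lambda>x. \<omega> x powr q) \<eta> \<longrightarrow>
        0 < \<theta>1 \<longrightarrow>
        (\<exists>C>0. \<forall>f \<in> BMO (critical_radius V) \<theta>1. \<forall>x0. \<forall>r>0.
           weighted_osc q \<omega> f (cube x0 r)
           \<le> ennreal (C * (1 + r / critical_radius V x0) powr ((N0 + 1) * \<theta>1 + \<eta> / q)) *
              bmo_norm (critical_radius V) \<theta>1 f))
     \<and>
     (\<forall>C>0. \<forall>\<theta>1>0. \<exists>C'>0. \<forall>(V :: real ^ 'n \<Rightarrow> real) \<omega> f.
        admissible_potential V \<longrightarrow>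
        \<omega> \<in> A_class (critical_radius V) \<theta>2 p q \<longrightarrow>
        locally_integrable f \<longrightarrow>
        (\<forall>x0. \<forall>r>0.
           weighted_osc q \<omega> f (cube x0 r)
           \<le> ennreal (C * (1 + r / critical_radius V x0) powr (\<theta>1 - \<theta>2))) \<longrightarrow>
        f \<in> BMO (critical_radius V) \<theta>1 \<and>
        bmo_norm (critical_radius V) \<theta>1 f
        \<le> ennreal C' * A_const (critical_radius V) \<theta>2 p q \<omega>)"
proof (intro conjI allI impI)
  fix V \<omega> :: "real ^ 'n \<Rightarrow> real" and N0 \<eta> \<theta>1 :: real
  assume w: "\<omega> \<in> A_class (critical_radius V) \<theta>2 p q"
    and "shen_exponent (critical_radius V) N0"
    and "rh_exponent (critical_radius V) (\<lambda>x. \<omega> x powr q) \<eta>" and "0 < \<theta>1"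
  moreover have "\<omega> \<in> borel_measurable lebesgue"
    using w by (simp add: A_class_def weight_def locally_integrable_measurable)
  ultimately show "\<exists>C>0. \<forall>f \<in> BMO (critical_radius V) \<theta>1. \<forall>x0. \<forall>r>0.
           weighted_osc q \<omega> f (cube x0 r)
           \<le> ennreal (C * (1 + r / critical_radius V x0) powr ((N0 + 1) * \<theta>1 + \<eta> / q)) *
              bmo_norm (critical_radius V) \<theta>1 f"
    using assms(2,3) by (intro weighted_osc_le_bmo_norm) auto
next
  fix C \<theta>1 :: real assume C: "0 < C"
  have q: "1 < q" using assms(2,3) by simp
  define C' where "C' = C * (2 * real CARD('n)) ^ CARD('n) * real CARD('n) powr \<theta>2"
  have C': "0 < C'" using C assms(1) by (simp add: C'_def)
  have "f \<in> BMO (critical_radius V) \<theta>1 \<and>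
      bmo_norm (critical_radius V) \<theta>1 f \<le> ennreal C' * A_const (critical_radius V) \<theta>2 p q \<omega>"
    if V: "admissible_potential V" and w: "\<omega> \<in> A_class (critical_radius V) \<theta>2 p q"
      and f: "locally_integrable f"
      and osc: "\<And>x0 r. 0 < r \<Longrightarrow> weighted_osc q \<omega> f (cube x0 r)
        \<le> ennreal (C * (1 + r / critical_radius V x0) powr (\<theta>1 - \<theta>2))"
    for V \<omega> f :: "real ^ 'n \<Rightarrow> real"
  proof -
    have weight: "weight \<omega>" and fin: "A_const (critical_radius V) \<theta>2 p q \<omega> < \<infinity>"
      using w by (simp_all add: A_class_def)
    have diag: "A_const (critical_radius V) \<theta>2 q q \<omega> \<le> A_const (critical_radius V) \<theta>2 p q \<omega>"
      using weight assms(2,3)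
      by (intro A_const_diagonal_le) (auto simp: weight_def locally_integrable_measurable)
    have pos: "0 < critical_radius V x" for x
      using critical_radius_pos[OF V] assms(1) by simp
    have "bmo_norm (critical_radius V) \<theta>1 f \<le> ennreal C' * A_const (critical_radius V) \<theta>2 q q \<omega>"
      using bmo_norm_le_A_const[OF pos q assms(4) C weight le_less_trans[OF diag fin] f osc]
      by (simp add: C'_def)
    also have "\<dots> \<le> ennreal C' * A_const (critical_radius V) \<theta>2 p q \<omega>"
      by (intro mult_left_mono diag) simp
    finally have le: "bmo_norm (critical_radius V) \<theta>1 f \<le> ennreal C' * A_const (critical_radius V) \<theta>2 p q \<omega>" .
    moreover have "ennreal C' * A_const (critical_radius V) \<theta>2 p q \<omega> < \<infinity>"
      using fin by (simp add: ennreal_mult_less_top)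
    ultimately show ?thesis
      using f by (auto simp: BMO_def intro: le_less_trans)
  qed
  then show "\<exists>C'>0. \<forall>(V :: real ^ 'n \<Rightarrow> real) \<omega> f.
        admissible_potential V \<longrightarrow>
        \<omega> \<in> A_class (critical_radius V) \<theta>2 p q \<longrightarrow>
        locally_integrable f \<longrightarrow>
        (\<forall>x0. \<forall>r>0.
           weighted_osc q \<omega> f (cube x0 r)
           \<le> ennreal (C * (1 + r / critical_radius V x0) powr (\<theta>1 - \<theta>2))) \<longrightarrow>
        f \<in> BMO (critical_radius V) \<theta>1 \<and>
        bmo_norm (critical_radius V) \<theta>1 f
        \<le> ennreal C' * A_const (critical_radius V) \<theta>2 p q \<omega>"
    using C' by blast
qed

end
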